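(* Let $A,B,C_1,\dots,C_m\in\mathbb{C}^{n\times n}$, $r_i,s_i\in\mathbb{C}^n$, $g_i\in\mathbb{C}^n\setminus\{0\}$ ($i=1,\dots,m$), let $N_s=\binom{n+m}{m+1}$, and let $\Delta_0,\Delta_1\in\mathbb{C}^{n^{m+1}\times n^{m+1}}$ be the operator determinants defined in the context. Suppose that the NEPv $$\Bigl(A+\lambda B+\frac{r_1^Tx}{s_1^Tx}C_1+\cdots+\frac{r_m^Tx}{s_m^Tx}C_m\Bigr)x=0$$ has exactly $N_s$ distinct solutions, that the pencil $(\Delta_1,\Delta_0)$ is regular and non-defective, and that $\sigma\in\mathbb{C}$ is not an eigenvalue of $(\Delta_1,\Delta_0)$. Let $z_k$ be a (nonzero) vector and let $z_{k+1}$ be obtained from it by one step of inverse iteration, $$(\Delta_1-\sigma\Delta_0)\tilde z_{k+1}=\Delta_0z_k,\qquad z_{k+1}=\frac{\tilde z_{k+1}}{\lVert\tilde z_{k+1}\rVert}.$$ If $z_k$ is symmetric, then $z_{k+1}$ is symmetric.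
   Context: A solution of the NEPv is a pair $(\lambda,x)$ with $\lambda\in\mathbb{C}$, $x\in\mathbb{C}^n\setminus\{0\}$ and $s_i^Tx\neq0$ for all $i$; solutions $(\lambda,x)$ and $(\lambda,\alpha x)$, $\alpha\ne0$, are identified. For a $k\times k$ array of square matrices $D_{i,j}$ (of size depending only on $i$) the operator determinant is $|D_{i,j}|_\otimes=\sum_{\pi\in S_k}\operatorname{sgn}(\pi)\,D_{1,\pi(1)}\otimes D_{2,\pi(2)}\otimes\cdots\otimes D_{k,\pi(k)}$, with $\otimes$ the Kronecker product. $\Delta_0$ is the operator determinant of the $(m+1)\times(m+1)$ array whose first row is $(B,C_1,\dots,C_m)$ and whose row $j+1$ ($j=1,\dots,m$) is $(B,C_1,\dots,C_{j}-g_js_j^T,\dots,C_m)$, i.e. the first row with $C_j$ replaced by $C_j-g_js_j^T$. $\Delta_1$ is obtained from the same array by replacing its first column by $(-A,\,-(A+g_1r_1^T),\dots,-(A+g_mr_m^T))$. The pencil $(\Delta_1,\Delta_0)$ stands for the generalized eigenvalue problem $\Delta_1z=\lambda\Delta_0z$; regular means $\det(\Delta_1-\lambda\Delta_0)\not\equiv0$, non-defective means that there is a basis of eigenvectors. A vector $z\in\mathbb{C}^{n^{m+1}}$ is called symmetric (symmetric decomposable) if $z=\sum_{j}\alpha_j\,x_j\otimes\cdots\otimes x_j$ ($m+1$ factors) for finitely many $x_j\in\mathbb{C}^n$, $\alpha_j\in\mathbb{C}$. *)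

theory Defs
  imports "Jordan_Normal_Form.VS_Connect"
begin

definition kron_mat :: "complex mat \<Rightarrow> complex mat \<Rightarrow> complex mat" where
  "kron_mat M M' = mat (dim_row M * dim_row M') (dim_col M * dim_col M')
     (\<lambda>(i, j). M $$ (i div dim_row M', j div dim_col M') *
               M' $$ (i mod dim_row M', j mod dim_col M'))"

definition kron_mats :: "complex mat list \<Rightarrow> complex mat" where
  "kron_mats Ms = foldr kron_mat Ms (1\<^sub>m 1)"

definition kron_vec :: "complex vec \<Rightarrow> complex vec \<Rightarrow> complex vec" where
  "kron_vec u v = vec (dim_vec u * dim_vec v)
     (\<lambda>i. u $ (i div dim_vec v) * v $ (i mod dim_vec v))"

definition kron_power :: "nat \<Rightarrow> complex vec \<Rightarrow> complex vec" where
  "kron_power k x = foldr kron_vec (replicate k x) (vec 1 (\<lambda>_. 1))"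

text \<open>Rows and columns of the array are indexed by \<open>0..<k\<close>; the blocks of row \<open>i\<close> are square
  matrices of a size that depends on \<open>i\<close> only, so that it can be read off from \<open>D i 0\<close>.
  The sum over permutations is taken entrywise.\<close>

definition op_det :: "nat \<Rightarrow> (nat \<Rightarrow> nat \<Rightarrow> complex mat) \<Rightarrow> complex mat" where
  "op_det k D = mat (\<Prod>i<k. dim_row (D i 0)) (\<Prod>i<k. dim_row (D i 0))
     (\<lambda>(a, b). \<Sum>p | p permutes {0..<k}.
        of_int (sign p) * kron_mats (map (\<lambda>i. D i (p i)) [0..<k]) $$ (a, b))"

text \<open>The families \<open>C\<close>, \<open>g\<close>, \<open>r\<close>, \<open>s\<close> are used at the indices \<open>1, \<dots>, m\<close>.
  Note that the product \<open>\<bullet>\<close> of vectors is bilinear, so \<open>r i \<bullet> x\<close> is the transpose product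
  without conjugation.\<close>

definition outer :: "complex vec \<Rightarrow> complex vec \<Rightarrow> complex mat" where
  "outer u v = mat (dim_vec u) (dim_vec v) (\<lambda>(i, j). u $ i * v $ j)"

definition nepv_mat :: "nat \<Rightarrow> nat \<Rightarrow> complex mat \<Rightarrow> complex mat \<Rightarrow> (nat \<Rightarrow> complex mat) \<Rightarrow>
    (nat \<Rightarrow> complex vec) \<Rightarrow> (nat \<Rightarrow> complex vec) \<Rightarrow> complex \<Rightarrow> complex vec \<Rightarrow> complex mat" where
  "nepv_mat n m A B C r s l x =
     A + l \<cdot>\<^sub>m B +
     mat n n (\<lambda>(a, b). \<Sum>i\<in>{1..m}. (((r i \<bullet> x) / (s i \<bullet> x)) \<cdot>\<^sub>m C i) $$ (a, b))"

definition nepv_solutions :: "nat \<Rightarrow> nat \<Rightarrow> complex mat \<Rightarrow> complex mat \<Rightarrow> (nat \<Rightarrow> complex mat) \<Rightarrow>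
    (nat \<Rightarrow> complex vec) \<Rightarrow> (nat \<Rightarrow> complex vec) \<Rightarrow> (complex \<times> complex vec) set" where
  "nepv_solutions n m A B C r s =
     {(l, x). x \<in> carrier_vec n \<and> x \<noteq> 0\<^sub>v n \<and> (\<forall>i\<in>{1..m}. s i \<bullet> x \<noteq> 0) \<and>
              nepv_mat n m A B C r s l x *\<^sub>v x = 0\<^sub>v n}"

definition scaling_rel :: "((complex \<times> complex vec) \<times> (complex \<times> complex vec)) set" where
  "scaling_rel = {((l, x), (l', x')). l' = l \<and> (\<exists>\<alpha>. \<alpha> \<noteq> 0 \<and> x' = \<alpha> \<cdot>\<^sub>v x)}"

definition Delta0_array :: "complex mat \<Rightarrow> (nat \<Rightarrow> complex mat) \<Rightarrow>
    (nat \<Rightarrow> complex vec) \<Rightarrow> (nat \<Rightarrow> complex vec) \<Rightarrow> nat \<Rightarrow> nat \<Rightarrow> complex mat" where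
  "Delta0_array B C g s i j =
     (if j = 0 then B else if i = j then C j - outer (g j) (s j) else C j)"

definition Delta1_array :: "complex mat \<Rightarrow> complex mat \<Rightarrow> (nat \<Rightarrow> complex mat) \<Rightarrow>
    (nat \<Rightarrow> complex vec) \<Rightarrow> (nat \<Rightarrow> complex vec) \<Rightarrow> (nat \<Rightarrow> complex vec) \<Rightarrow>
    nat \<Rightarrow> nat \<Rightarrow> complex mat" where
  "Delta1_array A B C g r s i j =
     (if j = 0 then (if i = 0 then - A else - (A + outer (g i) (r i)))
      else Delta0_array B C g s i j)"

definition Delta0 :: "nat \<Rightarrow> complex mat \<Rightarrow> (nat \<Rightarrow> complex mat) \<Rightarrow>
    (nat \<Rightarrow> complex vec) \<Rightarrow> (nat \<Rightarrow> complex vec) \<Rightarrow> complex mat" where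
  "Delta0 m B C g s = op_det (m + 1) (Delta0_array B C g s)"

definition Delta1 :: "nat \<Rightarrow> complex mat \<Rightarrow> complex mat \<Rightarrow> (nat \<Rightarrow> complex mat) \<Rightarrow>
    (nat \<Rightarrow> complex vec) \<Rightarrow> (nat \<Rightarrow> complex vec) \<Rightarrow> (nat \<Rightarrow> complex vec) \<Rightarrow> complex mat" where
  "Delta1 m A B C g r s = op_det (m + 1) (Delta1_array A B C g r s)"

text \<open>In all definitions below, the pencil \<open>(D1, D0)\<close> consists of two \<open>N \<times> N\<close> matrices and
  stands for the generalised eigenvalue problem \<open>D1 z = \<lambda> D0 z\<close>.\<close>

definition regular_pencil :: "complex mat \<Rightarrow> complex mat \<Rightarrow> bool" where
  "regular_pencil D1 D0 \<longleftrightarrow> (\<exists>l. det (D1 - l \<cdot>\<^sub>m D0) \<noteq> 0)"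

definition pencil_eigenvector :: "nat \<Rightarrow> complex mat \<Rightarrow> complex mat \<Rightarrow> complex \<Rightarrow> complex vec \<Rightarrow> bool"
  where
  "pencil_eigenvector N D1 D0 l z \<longleftrightarrow>
     z \<in> carrier_vec N \<and> z \<noteq> 0\<^sub>v N \<and> D1 *\<^sub>v z = l \<cdot>\<^sub>v (D0 *\<^sub>v z)"

definition pencil_eigenvalue :: "nat \<Rightarrow> complex mat \<Rightarrow> complex mat \<Rightarrow> complex \<Rightarrow> bool" where
  "pencil_eigenvalue N D1 D0 l \<longleftrightarrow> (\<exists>z. pencil_eigenvector N D1 D0 l z)"

definition pencil_eigenvector_infinity :: "nat \<Rightarrow> complex mat \<Rightarrow> complex vec \<Rightarrow> bool" where
  "pencil_eigenvector_infinity N D0 z \<longleftrightarrow> z \<in> carrier_vec N \<and> z \<noteq> 0\<^sub>v N \<and> D0 *\<^sub>v z = 0\<^sub>v N"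

text \<open>As usual for regular pencils, the matrix \<open>D0\<close> may be singular, in which case the nonzero
  vectors of its kernel are the eigenvectors for the eigenvalue \<open>\<infinity>\<close>. They are allowed in the
  basis; when \<open>D0\<close> is invertible there are none.\<close>

definition nondefective_pencil :: "nat \<Rightarrow> complex mat \<Rightarrow> complex mat \<Rightarrow> bool" where
  "nondefective_pencil N D1 D0 \<longleftrightarrow>
     (\<exists>E. vectorspace.basis class_ring (module_vec TYPE(complex) N) E \<and>
          (\<forall>z\<in>E. (\<exists>l. pencil_eigenvector N D1 D0 l z) \<or> pencil_eigenvector_infinity N D0 z))"

definition symmetric_vec :: "nat \<Rightarrow> nat \<Rightarrow> complex vec \<Rightarrow> bool" where
  "symmetric_vec n k z \<longleftrightarrow>
     (\<exists>p (\<alpha> :: nat \<Rightarrow> complex) x. (\<forall>j<p. x j \<in> carrier_vec n) \<and>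
        z = finsum_vec TYPE(complex) (n ^ k) (\<lambda>j. \<alpha> j \<cdot>\<^sub>v kron_power k (x j)) {..<p})"

definition vec_norm :: "complex vec \<Rightarrow> real" where
  "vec_norm z = sqrt (\<Sum>i<dim_vec z. (cmod (z $ i))\<^sup>2)"

lemma kron_mat_carrier [simp]:
  "M \<in> carrier_mat a b \<Longrightarrow> M' \<in> carrier_mat c d \<Longrightarrow> kron_mat M M' \<in> carrier_mat (a * c) (b * d)"
  by (auto simp: kron_mat_def)

lemma kron_mats_carrier:
  assumes "\<And>M. M \<in> set Ms \<Longrightarrow> M \<in> carrier_mat n n"
  shows "kron_mats Ms \<in> carrier_mat (n ^ length Ms) (n ^ length Ms)"
  using assms
proof (induction Ms)
  case Nil
  show ?case by (simp add: kron_mats_def)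
next
  case (Cons M Ms)
  then have "kron_mat M (kron_mats Ms) \<in> carrier_mat (n * n ^ length Ms) (n * n ^ length Ms)"
    by (intro kron_mat_carrier) auto
  then show ?case by (simp add: kron_mats_def)
qed

lemma kron_power_carrier:
  assumes "x \<in> carrier_vec n"
  shows "kron_power k x \<in> carrier_vec (n ^ k)"
proof (induction k)
  case 0
  show ?case by (simp add: kron_power_def)
next
  case (Suc k)
  have "kron_power (Suc k) x = kron_vec x (kron_power k x)"
    by (simp add: kron_power_def)
  moreover have "kron_vec x (kron_power k x) \<in> carrier_vec (n * n ^ k)"
    unfolding kron_vec_def using assms Suc.IH by (metis carrier_vecD vec_carrier)
  ultimately show ?case by simp
qed

lemma op_det_carrier:
  assumes "\<And>i. i < k \<Longrightarrow> dim_row (D i 0) = n"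
  shows "op_det k D \<in> carrier_mat (n ^ k) (n ^ k)"
  using assms by (simp add: op_det_def)

lemma Delta0_carrier:
  assumes "B \<in> carrier_mat n n"
  shows "Delta0 m B C g s \<in> carrier_mat (n ^ (m + 1)) (n ^ (m + 1))"
  unfolding Delta0_def by (rule op_det_carrier) (use assms in \<open>auto simp: Delta0_array_def\<close>)

lemma Delta1_carrier:
  assumes "A \<in> carrier_mat n n" "\<And>i. i \<in> {1..m} \<Longrightarrow> g i \<in> carrier_vec n"
  shows "Delta1 m A B C g r s \<in> carrier_mat (n ^ (m + 1)) (n ^ (m + 1))"
  unfolding Delta1_def
  by (rule op_det_carrier) (use assms in \<open>auto simp: Delta1_array_def outer_def\<close>)

end

theory Submission
  imports Defs
begin

text \<open>
  The idea is that the solutions of the NEPv provide a basis of the space of symmetric vectors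
  that consists of eigenvectors of the pencil; inverse iteration acts diagonally on this basis and
  so cannot leave the space.

  \<^bold>\<open>Solutions give eigenvectors.\<close> Let \<open>(\<lambda>, x)\<close> be a solution and put \<open>\<nu>\<^sub>0 = \<lambda>\<close> and
  \<open>\<nu>\<^sub>j = (r\<^sub>j \<bullet> x) / (s\<^sub>j \<bullet> x)\<close>. Since \<open>g\<^sub>j (r\<^sub>j \<bullet> x) = \<nu>\<^sub>j g\<^sub>j (s\<^sub>j \<bullet> x)\<close>, the vector \<open>x\<close> solves all
  \<open>m + 1\<close> equations of a linear multiparameter eigenvalue problem with eigenvalue tuple \<open>\<nu>\<close>. On a
  Kronecker power \<open>z = x \<otimes> \<dots> \<otimes> x\<close> an operator determinant is, entry by entry, an ordinary scalar
  determinant, so Cramer's rule turns these equations into \<open>\<Delta>\<^sup>(\<^sup>l\<^sup>) z = \<nu>\<^sub>l \<Delta>\<^sub>0 z\<close> for all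
  \<open>l = 0, \<dots>, m\<close>, where \<open>\<Delta>\<^sup>(\<^sup>l\<^sup>)\<close> is \<open>\<Delta>\<^sub>0\<close> with the column \<open>l\<close> of its array replaced by the
  \<open>A\<close>-column (\<open>nepv_solution_Delta_eigenvector\<close>); in particular \<open>\<Delta>\<^sup>(\<^sup>0\<^sup>) = \<Delta>\<^sub>1\<close>.

  \<^bold>\<open>These eigenvectors are independent.\<close> Different solutions may share the eigenvalue \<open>\<lambda>\<close>,
  but they cannot share the whole tuple \<open>\<nu>\<close>: all the matrices of the NEPv would agree along the
  line through the two vectors, and almost every point of that line would be a further solution,
  although there are only finitely many up to scaling
  (\<open>nepv_params_separate_solutions\<close>). Hence a generic
  combination \<open>\<Sum>\<^sub>j \<epsilon>\<^sup>j \<Delta>\<^sup>(\<^sup>j\<^sup>)\<close> separates the vectors \<open>z\<close> by its eigenvalues, and for generic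
  \<open>\<epsilon>\<close> its pencil with \<open>\<Delta>\<^sub>0\<close> inherits regularity from \<open>\<epsilon> = 0\<close>, where it is the given pencil
  (\<open>joint_eigenvectors_independent\<close>).

  \<^bold>\<open>They span the symmetric vectors.\<close> The entries of \<open>x \<otimes> \<dots> \<otimes> x\<close> are the monomials of
  degree \<open>m + 1\<close> in the \<open>n\<close> coordinates of \<open>x\<close>. There are \<open>n + m choose (m + 1)\<close> of these, which
  is the number of solutions (\<open>independent_kron_powers_span_symmetric\<close>).

  Finally, if \<open>z\<^sub>k = \<Sum>\<^sub>i c\<^sub>i z\<^sub>i\<close> with \<open>\<Delta>\<^sub>1 z\<^sub>i = \<lambda>\<^sub>i \<Delta>\<^sub>0 z\<^sub>i\<close>, then \<open>\<Sum>\<^sub>i c\<^sub>i / (\<lambda>\<^sub>i - \<sigma>) z\<^sub>i\<close> solves the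
  equation of the inverse iteration step. It is the only solution, as \<open>\<sigma>\<close> is not an eigenvalue.
\<close>

section \<open>Linear combinations of vectors\<close>

text \<open>The sum is taken entrywise, so that identities between linear combinations reduce to
  identities between sums of complex numbers.\<close>

definition lin_comb :: "nat \<Rightarrow> 'b set \<Rightarrow> ('b \<Rightarrow> complex) \<Rightarrow> ('b \<Rightarrow> complex vec) \<Rightarrow> complex vec" where
  "lin_comb N I a z = vec N (\<lambda>b. \<Sum>i\<in>I. a i * z i $ b)"

lemma lin_comb_carrier [simp]: "lin_comb N I a z \<in> carrier_vec N"
  by (simp add: lin_comb_def)

lemma lin_comb_cong:
  "(\<And>i. i \<in> I \<Longrightarrow> a i \<cdot>\<^sub>v z i = b i \<cdot>\<^sub>v w i) \<Longrightarrow> (\<And>i. i \<in> I \<Longrightarrow> z i \<in> carrier_vec N \<and> w i \<in> carrier_vec N)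
    \<Longrightarrow> lin_comb N I a z = lin_comb N I b w"
  unfolding lin_comb_def
  by (intro eq_vecI) (auto intro!: sum.cong dest!: arg_cong[where f = "\<lambda>v. v $ _"], metis carrier_vecD index_smult_vec(1))

lemma mult_mat_vec_lin_comb:
  assumes "M \<in> carrier_mat N N" "\<And>i. i \<in> I \<Longrightarrow> z i \<in> carrier_vec N"
  shows "M *\<^sub>v lin_comb N I a z = lin_comb N I a (\<lambda>i. M *\<^sub>v z i)"
proof (rule eq_vecI)
  fix b assume "b < dim_vec (lin_comb N I a (\<lambda>i. M *\<^sub>v z i))"
  then have b: "b < N" by (simp add: lin_comb_def)
  have "(M *\<^sub>v lin_comb N I a z) $ b = (\<Sum>c<N. \<Sum>i\<in>I. M $$ (b,c) * (a i * z i $ c))"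
    using assms b by (simp add: lin_comb_def scalar_prod_def sum_distrib_left atLeast0LessThan)
  also have "\<dots> = (\<Sum>i\<in>I. \<Sum>c<N. M $$ (b,c) * (a i * z i $ c))"
    by (rule sum.swap)
  also have "\<dots> = (\<Sum>i\<in>I. a i * (M *\<^sub>v z i) $ b)"
  proof (rule sum.cong[OF refl])
    fix i assume "i \<in> I"
    then have "dim_vec (z i) = N" using assms(2) by (metis carrier_vecD)
    then show "(\<Sum>c<N. M $$ (b,c) * (a i * z i $ c)) = a i * (M *\<^sub>v z i) $ b"
      using assms(1) b by (simp add: scalar_prod_def sum_distrib_left atLeast0LessThan mult_ac)
  qed
  finally show "(M *\<^sub>v lin_comb N I a z) $ b = lin_comb N I a (\<lambda>i. M *\<^sub>v z i) $ b"
    using b by (simp add: lin_comb_def)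
qed (use assms in \<open>simp add: lin_comb_def\<close>)

section \<open>Independence of eigenvectors of pencils\<close>

lemma injective_if_det_nonzero:
  fixes M :: "complex mat"
  assumes "M \<in> carrier_mat N N" "det M \<noteq> 0" "v \<in> carrier_vec N" "M *\<^sub>v v = 0\<^sub>v N"
  shows "v = 0\<^sub>v N"
  using assms det_0_iff_vec_prod_zero by blast

text \<open>This is the classical induction for eigenvectors of distinct eigenvalues, adapted to a pencil
  whose second matrix \<open>D\<close> may be singular. Applying \<open>P\<close> to a vanishing combination and subtracting
  \<open>\<kappa>\<^sub>j D\<close> of it eliminates \<open>z\<^sub>j\<close>, but leaves a combination of the \<open>D z\<^sub>i\<close>. Since \<open>P\<close> is injective,
  no \<open>\<kappa>\<^sub>i\<close> vanishes, so \<open>D z\<^sub>i = P z\<^sub>i / \<kappa>\<^sub>i\<close> and \<open>P\<close> can be cancelled.\<close>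

lemma pencil_eigenvectors_independent:
  assumes P: "P \<in> carrier_mat N N" and D: "D \<in> carrier_mat N N" and det: "det P \<noteq> 0"
    and z: "\<And>i. i \<in> I \<Longrightarrow> z i \<in> carrier_vec N \<and> z i \<noteq> 0\<^sub>v N"
    and ev: "\<And>i. i \<in> I \<Longrightarrow> P *\<^sub>v z i = \<kappa> i \<cdot>\<^sub>v (D *\<^sub>v z i)"
    and inj: "inj_on \<kappa> I" and fin: "finite I" and zero: "lin_comb N I a z = 0\<^sub>v N"
  shows "\<forall>i\<in>I. a i = 0"
  using fin z ev inj zero
proof (induction I arbitrary: a rule: finite_induct)
  case (insert j I)
  have Dz: "D *\<^sub>v z i \<in> carrier_vec N" "P *\<^sub>v z i \<in> carrier_vec N" "z i \<in> carrier_vec N" if "i \<in> insert j I" for i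
    using that insert.prems D P by auto
  have \<kappa>: "\<kappa> i \<noteq> 0" if "i \<in> insert j I" for i
  proof
    assume "\<kappa> i = 0"
    then have "P *\<^sub>v z i = 0\<^sub>v N"
      using insert.prems(2)[OF that] D insert.prems(1)[OF that] by (auto intro!: eq_vecI)
    then show False
      using injective_if_det_nonzero[OF P det] insert.prems(1)[OF that] by blast
  qed
  have M0: "M *\<^sub>v 0\<^sub>v N = 0\<^sub>v N" if "M \<in> carrier_mat N N" for M :: "complex mat"
    using that by (auto intro!: eq_vecI)
  have 1: "lin_comb N (insert j I) a (\<lambda>i. D *\<^sub>v z i) = 0\<^sub>v N"
    using mult_mat_vec_lin_comb[OF D, of "insert j I" z a] insert.prems(4) Dz(3) M0[OF D] by simp
  have "lin_comb N (insert j I) a (\<lambda>i. P *\<^sub>v z i) = 0\<^sub>v N"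
    using mult_mat_vec_lin_comb[OF P, of "insert j I" z a] insert.prems(4) Dz(3) M0[OF P] by simp
  then have 2: "lin_comb N (insert j I) (\<lambda>i. a i * \<kappa> i) (\<lambda>i. D *\<^sub>v z i) = 0\<^sub>v N"
    by (subst lin_comb_cong[where b = a and w = "\<lambda>i. P *\<^sub>v z i"])
      (use insert.prems(2) Dz in \<open>auto simp: smult_smult_assoc\<close>)
  define b where "b i = a i * (\<kappa> i - \<kappa> j) / \<kappa> i" for i
  have "P *\<^sub>v lin_comb N I b z = lin_comb N I b (\<lambda>i. P *\<^sub>v z i)"
    by (rule mult_mat_vec_lin_comb[OF P]) (use Dz in auto)
  also have "\<dots> = lin_comb N I (\<lambda>i. a i * (\<kappa> i - \<kappa> j)) (\<lambda>i. D *\<^sub>v z i)"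
    by (rule lin_comb_cong)
      (use insert.prems(2) Dz \<kappa> in \<open>auto simp: smult_smult_assoc b_def\<close>)
  also have "\<dots> = 0\<^sub>v N"
  proof (rule eq_vecI)
    fix c assume "c < dim_vec (0\<^sub>v N :: complex vec)"
    then have c: "c < N" by simp
    have e1: "(\<Sum>i\<in>insert j I. a i * (D *\<^sub>v z i) $ c) = 0"
      using arg_cong[OF 1, of "\<lambda>v. v $ c"] c by (simp only: lin_comb_def index_vec index_zero_vec)
    have e2: "(\<Sum>i\<in>insert j I. a i * \<kappa> i * (D *\<^sub>v z i) $ c) = 0"
      using arg_cong[OF 2, of "\<lambda>v. v $ c"] c by (simp only: lin_comb_def index_vec index_zero_vec)
    have "(\<Sum>i\<in>I. a i * (\<kappa> i - \<kappa> j) * (D *\<^sub>v z i) $ c)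
        = (\<Sum>i\<in>insert j I. a i * \<kappa> i * (D *\<^sub>v z i) $ c) - \<kappa> j * (\<Sum>i\<in>insert j I. a i * (D *\<^sub>v z i) $ c)"
      using insert.hyps by (simp add: sum_distrib_left sum_subtractf algebra_simps)
    then show "lin_comb N I (\<lambda>i. a i * (\<kappa> i - \<kappa> j)) (\<lambda>i. D *\<^sub>v z i) $ c = 0\<^sub>v N $ c"
      using c e1 e2 by (simp add: lin_comb_def)
  qed (simp add: lin_comb_def)
  finally have "lin_comb N I b z = 0\<^sub>v N"
    using injective_if_det_nonzero[OF P det] by simp
  then have "\<forall>i\<in>I. b i = 0"
    using insert.prems by (intro insert.IH) (auto simp: inj_on_def)
  moreover have "\<kappa> i \<noteq> \<kappa> j" if "i \<in> I" for i
    using that insert.prems(3) insert.hyps by (auto simp: inj_on_def)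
  ultimately have aI: "\<forall>i\<in>I. a i = 0"
    using \<kappa> by (auto simp: b_def)
  obtain c where c: "c < N" "z j $ c \<noteq> 0"
    using insert.prems(1)[of j] by (metis carrier_vecD eq_vecI index_zero_vec insertI1)
  have "(\<Sum>i\<in>insert j I. a i * z i $ c) = 0"
    using arg_cong[OF insert.prems(4), of "\<lambda>v. v $ c"] c by (simp only: lin_comb_def index_vec index_zero_vec)
  then show ?case
    using aI insert.hyps c by simp
qed simp

text \<open>No single pencil \<open>(\<Delta> j, D)\<close> needs to separate the vectors; the generic combination
  \<open>\<Sum>\<^sub>j \<epsilon>\<^sup>j \<Delta> j\<close> does. Its eigenvalues \<open>\<Sum>\<^sub>j \<epsilon>\<^sup>j \<nu> i j\<close> and the determinant of its pencil at \<open>t\<close> are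
  polynomials in \<open>\<epsilon>\<close>, so only finitely many \<open>\<epsilon>\<close> make two eigenvalues coincide or the
  determinant vanish.\<close>

lemma joint_eigenvectors_independent:
  fixes \<Delta> :: "nat \<Rightarrow> complex mat"
  assumes D: "D \<in> carrier_mat N N" and \<Delta>: "\<And>j. j \<le> m \<Longrightarrow> \<Delta> j \<in> carrier_mat N N"
    and reg: "det (\<Delta> 0 - t \<cdot>\<^sub>m D) \<noteq> 0"
    and z: "\<And>i. i \<in> I \<Longrightarrow> z i \<in> carrier_vec N \<and> z i \<noteq> 0\<^sub>v N"
    and ev: "\<And>i j. i \<in> I \<Longrightarrow> j \<le> m \<Longrightarrow> \<Delta> j *\<^sub>v z i = \<nu> i j \<cdot>\<^sub>v (D *\<^sub>v z i)"
    and dist: "\<And>i i'. i \<in> I \<Longrightarrow> i' \<in> I \<Longrightarrow> i \<noteq> i' \<Longrightarrow> \<exists>j\<le>m. \<nu> i j \<noteq> \<nu> i' j"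
    and fin: "finite I" and zero: "lin_comb N I a z = 0\<^sub>v N"
  shows "\<forall>i\<in>I. a i = 0"
proof -
  \<comment> \<open>the difference of the eigenvalues of \<open>z i\<close> and \<open>z i'\<close>, as a polynomial in \<open>\<epsilon>\<close>\<close>
  define q where "q i i' = (\<Sum>j\<le>m. monom (\<nu> i j - \<nu> i' j) j)" for i i'
  have "q i i' \<noteq> 0" if ii: "i \<in> I" "i' \<in> I" "i \<noteq> i'" for i i'
  proof -
    obtain j where j: "j \<le> m" "\<nu> i j \<noteq> \<nu> i' j" using dist[OF ii] by blast
    have "coeff (q i i') j = (\<Sum>l\<le>m. if l = j then \<nu> i j - \<nu> i' j else 0)"
      unfolding q_def by (auto simp: coeff_sum intro!: sum.cong)
    then have "coeff (q i i') j \<noteq> 0" using j by simp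
    then show ?thesis by auto
  qed
  then have finq: "finite {\<epsilon>. poly (q i i') \<epsilon> = 0}" if "i \<in> I" "i' \<in> I" "i \<noteq> i'" for i i'
    using that by (intro poly_roots_finite)
  \<comment> \<open>\<open>P \<epsilon>\<close> is the pencil at \<open>t\<close>, and \<open>M\<close> is the same matrix with polynomial entries\<close>
  define M where "M = mat N N (\<lambda>(b, c). (\<Sum>j\<le>m. monom (\<Delta> j $$ (b, c)) j) - [: t * D $$ (b, c) :])"
  define P where "P \<epsilon> = mat N N (\<lambda>(b, c). (\<Sum>j\<le>m. \<epsilon> ^ j * \<Delta> j $$ (b, c)) - t * D $$ (b, c))" for \<epsilon>
  have detP: "det (P \<epsilon>) = poly (det M) \<epsilon>" for \<epsilon>
  proof -
    interpret poly_eval: comm_ring_hom "\<lambda>p. poly p \<epsilon>" by unfold_locales auto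
    have "P \<epsilon> = map_mat (\<lambda>p. poly p \<epsilon>) M"
      by (intro eq_matI) (auto simp: P_def M_def poly_sum poly_monom mult.commute)
    then show ?thesis by simp
  qed
  \<comment> \<open>at \<open>\<epsilon> = 0\<close> only the term for \<open>j = 0\<close> survives, because \<open>0 ^ 0 = 1\<close>\<close>
  have "P 0 = \<Delta> 0 - t \<cdot>\<^sub>m D"
  proof (rule eq_matI)
    fix b c assume "b < dim_row (\<Delta> 0 - t \<cdot>\<^sub>m D)" "c < dim_col (\<Delta> 0 - t \<cdot>\<^sub>m D)"
    then have "b < N" "c < N" using D by auto
    moreover have "(\<Sum>j\<le>m. 0 ^ j * \<Delta> j $$ (b, c)) = (\<Sum>j\<le>m. if j = 0 then \<Delta> 0 $$ (b, c) else 0)"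
      by (intro sum.cong) auto
    ultimately show "P 0 $$ (b, c) = (\<Delta> 0 - t \<cdot>\<^sub>m D) $$ (b, c)"
      using D by (simp add: P_def)
  qed (use D in \<open>auto simp: P_def\<close>)
  then have "det M \<noteq> 0" using reg detP[of 0] by auto
  then have finM: "finite {\<epsilon>. poly (det M) \<epsilon> = 0}" by (rule poly_roots_finite)
  have "finite ({\<epsilon>. poly (det M) \<epsilon> = 0} \<union>
      (\<Union>i\<in>I. \<Union>i'\<in>I - {i}. {\<epsilon>. poly (q i i') \<epsilon> = 0}))"
    using fin finM finq by auto
  then obtain \<epsilon> where \<epsilon>: "\<epsilon> \<notin> {\<epsilon>. poly (det M) \<epsilon> = 0} \<union>
      (\<Union>i\<in>I. \<Union>i'\<in>I - {i}. {\<epsilon>. poly (q i i') \<epsilon> = 0})"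
    using ex_new_if_finite[OF infinite_UNIV_char_0] by blast
  define \<kappa> where "\<kappa> i = (\<Sum>j\<le>m. \<epsilon> ^ j * \<nu> i j) - t" for i
  show ?thesis
  proof (rule pencil_eigenvectors_independent[where P = "P \<epsilon>" and D = D and \<kappa> = \<kappa>])
    show "P \<epsilon> \<in> carrier_mat N N" by (simp add: P_def)
    show "det (P \<epsilon>) \<noteq> 0" using \<epsilon> detP by simp
    have "\<kappa> i - \<kappa> i' = poly (q i i') \<epsilon>" for i i'
      by (simp add: \<kappa>_def q_def poly_sum poly_monom sum_subtractf algebra_simps)
    then show "inj_on \<kappa> I"
      using \<epsilon> by (intro inj_onI) (metis (mono_tags, lifting) DiffI UN_I UnI2 empty_iff insert_iff mem_Collect_eq right_minus_eq)
    fix i assume i: "i \<in> I"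
    show "P \<epsilon> *\<^sub>v z i = \<kappa> i \<cdot>\<^sub>v (D *\<^sub>v z i)"
    proof (rule eq_vecI)
      fix b assume "b < dim_vec (\<kappa> i \<cdot>\<^sub>v (D *\<^sub>v z i))"
      then have b: "b < N" using D by simp
      have dz: "dim_vec (z i) = N" using z[OF i] by auto
      have Mz: "(M *\<^sub>v z i) $ b = (\<Sum>c<N. M $$ (b, c) * z i $ c)" if "M \<in> carrier_mat N N" for M
        using that b dz by (simp add: scalar_prod_def atLeast0LessThan)
      have "(P \<epsilon> *\<^sub>v z i) $ b = (\<Sum>c<N. ((\<Sum>j\<le>m. \<epsilon> ^ j * \<Delta> j $$ (b, c)) - t * D $$ (b, c)) * z i $ c)"
        using b dz by (simp add: P_def scalar_prod_def atLeast0LessThan)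
      also have "\<dots> = (\<Sum>c<N. \<Sum>j\<le>m. \<epsilon> ^ j * (\<Delta> j $$ (b, c) * z i $ c)) - (\<Sum>c<N. t * (D $$ (b, c) * z i $ c))"
        by (simp add: left_diff_distrib sum_subtractf sum_distrib_right mult.assoc)
      also have "\<dots> = (\<Sum>j\<le>m. \<epsilon> ^ j * (\<Sum>c<N. \<Delta> j $$ (b, c) * z i $ c)) - t * (\<Sum>c<N. D $$ (b, c) * z i $ c)"
        unfolding sum_distrib_left by (subst sum.swap) (rule refl)
      also have "\<dots> = (\<Sum>j\<le>m. \<epsilon> ^ j * (\<Delta> j *\<^sub>v z i) $ b) - t * (D *\<^sub>v z i) $ b"
        by (simp add: Mz[OF D] Mz[OF \<Delta>] del: index_mult_mat_vec)
      also have "\<dots> = (\<Sum>j\<le>m. \<epsilon> ^ j * (\<nu> i j * (D *\<^sub>v z i) $ b)) - t * (D *\<^sub>v z i) $ b"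
      proof -
        have "(\<Delta> j *\<^sub>v z i) $ b = \<nu> i j * (D *\<^sub>v z i) $ b" if "j \<le> m" for j
          unfolding ev[OF i that] using D b by (intro index_smult_vec) simp
        then show ?thesis by simp
      qed
      also have "\<dots> = \<kappa> i * (D *\<^sub>v z i) $ b"
        by (simp add: \<kappa>_def left_diff_distrib sum_distrib_right mult.assoc del: index_mult_mat_vec)
      also have "\<dots> = (\<kappa> i \<cdot>\<^sub>v (D *\<^sub>v z i)) $ b"
        using D b by (intro index_smult_vec(1)[symmetric]) simp
      finally show "(P \<epsilon> *\<^sub>v z i) $ b = (\<kappa> i \<cdot>\<^sub>v (D *\<^sub>v z i)) $ b" .
    qed (use D in \<open>simp add: P_def\<close>)
  qed (use D z fin zero in auto)
qed

section \<open>Kronecker products and powers\<close>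

text \<open>The \<open>k\<close> digits of \<open>a\<close> in base \<open>n\<close>, the most significant one first: an index of a Kronecker
  product of \<open>k\<close> factors of dimension \<open>n\<close> encodes in this way one index for each factor.\<close>

fun digits :: "nat \<Rightarrow> nat \<Rightarrow> nat \<Rightarrow> nat list" where
  "digits n 0 a = []"
| "digits n (Suc k) a = a div n ^ k # digits n k (a mod n ^ k)"

lemma length_digits [simp]: "length (digits n k a) = k"
  by (induction k arbitrary: a) auto

lemma set_digits: "a < n ^ k \<Longrightarrow> set (digits n k a) \<subseteq> {..<n}"
proof (induction k arbitrary: a)
  case (Suc k)
  then have "n ^ k > 0" by (cases "n = 0") auto
  then show ?case
    using Suc.IH[of "a mod n ^ k"] Suc.prems by (auto simp: less_mult_imp_div_less)
qed simp

lemma kron_vecs_index: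
  assumes "\<And>v. v \<in> set vs \<Longrightarrow> dim_vec v = n"
  shows "dim_vec (foldr kron_vec vs (vec 1 (\<lambda>_. 1))) = n ^ length vs \<and>
    (\<forall>a < n ^ length vs. foldr kron_vec vs (vec 1 (\<lambda>_. 1)) $ a
      = (\<Prod>i<length vs. vs ! i $ (digits n (length vs) a ! i)))"
  using assms
proof (induction vs)
  case (Cons v vs)
  let ?w = "foldr kron_vec vs (vec 1 (\<lambda>_. 1))"
  have IH: "dim_vec ?w = n ^ length vs"
    "\<And>a. a < n ^ length vs \<Longrightarrow> ?w $ a = (\<Prod>i<length vs. vs ! i $ (digits n (length vs) a ! i))"
    using Cons by auto
  have v: "dim_vec v = n" using Cons by simp
  have pos: "n ^ length vs > 0" if "a < n * n ^ length vs" for a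
    using that by (cases "n = 0") auto
  have "foldr kron_vec (v # vs) (vec 1 (\<lambda>_. 1)) = kron_vec v ?w" by simp
  moreover have "kron_vec v w = vec (n * n ^ length vs) (\<lambda>a. v $ (a div n ^ length vs) * w $ (a mod n ^ length vs))"
    if "dim_vec w = n ^ length vs" for w
    using that v by (simp add: kron_vec_def)
  ultimately show ?case
    using pos IH by (auto simp: prod.lessThan_Suc_shift simp del: prod.lessThan_Suc)
qed simp

lemma kron_power_Suc: "kron_power (Suc k) x = kron_vec x (kron_power k x)"
  by (simp add: kron_power_def)

lemma sum_product_div_mod:
  fixes f :: "nat \<Rightarrow> nat \<Rightarrow> 'c :: comm_monoid_add"
  shows "(\<Sum>j<p * q. f (j div q) (j mod q)) = (\<Sum>i<p. \<Sum>j<q. f i j)"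
proof -
  have "(\<Sum>j<p * q. f (j div q) (j mod q)) = (\<Sum>i<p. \<Sum>j\<in>{i * q..<i * q + q}. f (j div q) (j mod q))"
    by (rule sum.nat_group[symmetric])
  also have "\<dots> = (\<Sum>i<p. \<Sum>j<q. f i j)"
  proof (rule sum.cong[OF refl])
    fix i
    have "(\<Sum>j\<in>{0 + i * q..<q + i * q}. f (j div q) (j mod q)) = (\<Sum>j\<in>{0..<q}. f ((j + i * q) div q) ((j + i * q) mod q))"
      by (rule sum.shift_bounds_nat_ivl)
    then show "(\<Sum>j\<in>{i * q..<i * q + q}. f (j div q) (j mod q)) = (\<Sum>j<q. f i j)"
      by (simp add: atLeast0LessThan add.commute)
  qed
  finally show ?thesis .
qed

text \<open>The mixed product property: the double sum over the two inner indices factors.\<close>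

lemma kron_mat_mult_kron_vec:
  assumes M: "M \<in> carrier_mat p p" and M': "M' \<in> carrier_mat q q"
    and u: "u \<in> carrier_vec p" and v: "v \<in> carrier_vec q"
  shows "kron_mat M M' *\<^sub>v kron_vec u v = kron_vec (M *\<^sub>v u) (M' *\<^sub>v v)"
proof (rule eq_vecI)
  fix a assume "a < dim_vec (kron_vec (M *\<^sub>v u) (M' *\<^sub>v v))"
  then have a: "a < p * q" using M M' by (simp add: kron_vec_def)
  then have q: "q > 0" by (cases "q = 0") auto
  then have dm: "a div q < p" "a mod q < q" using a by (auto simp: less_mult_imp_div_less)
  have "(kron_mat M M' *\<^sub>v kron_vec u v) $ a
     = (\<Sum>j<p * q. (M $$ (a div q, j div q) * M' $$ (a mod q, j mod q)) * (u $ (j div q) * v $ (j mod q)))"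
    using a M M' u v by (auto simp: scalar_prod_def kron_mat_def kron_vec_def atLeast0LessThan)
  also have "\<dots> = (\<Sum>i<p. \<Sum>j<q. (M $$ (a div q, i) * M' $$ (a mod q, j)) * (u $ i * v $ j))"
    by (rule sum_product_div_mod)
  also have "\<dots> = (\<Sum>i<p. M $$ (a div q, i) * u $ i) * (\<Sum>j<q. M' $$ (a mod q, j) * v $ j)"
    by (simp add: sum_product mult_ac)
  also have "\<dots> = kron_vec (M *\<^sub>v u) (M' *\<^sub>v v) $ a"
    using a dm M M' u v by (simp add: scalar_prod_def kron_vec_def atLeast0LessThan)
  finally show "(kron_mat M M' *\<^sub>v kron_vec u v) $ a = kron_vec (M *\<^sub>v u) (M' *\<^sub>v v) $ a" .
qed (use M M' in \<open>auto simp: kron_mat_def kron_vec_def\<close>)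

lemma kron_mats_mult_kron_power:
  assumes "\<And>M. M \<in> set Ms \<Longrightarrow> M \<in> carrier_mat n n" and x: "x \<in> carrier_vec n"
  shows "kron_mats Ms *\<^sub>v kron_power (length Ms) x
    = foldr kron_vec (map (\<lambda>M. M *\<^sub>v x) Ms) (vec 1 (\<lambda>_. 1))"
  using assms(1)
proof (induction Ms)
  case Nil
  show ?case by (simp add: kron_mats_def kron_power_def)
next
  case (Cons M Ms)
  have "kron_mats (M # Ms) *\<^sub>v kron_power (length (M # Ms)) x
      = kron_vec (M *\<^sub>v x) (kron_mats Ms *\<^sub>v kron_power (length Ms) x)"
    using kron_mat_mult_kron_vec[of M n "kron_mats Ms" "n ^ length Ms" x "kron_power (length Ms) x"]
      kron_mats_carrier[of Ms n] kron_power_carrier[OF x] Cons.prems x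
    by (simp add: kron_power_Suc kron_mats_def)
  then show ?case using Cons by simp
qed

lemma kron_power_index:
  assumes "x \<in> carrier_vec n" "a < n ^ k"
  shows "kron_power k x $ a = (\<Prod>i<k. x $ (digits n k a ! i))"
  using kron_vecs_index[of "replicate k x" n] assms by (auto simp: kron_power_def)

lemma kron_power_nonzero:
  assumes x: "x \<in> carrier_vec n" "x \<noteq> 0\<^sub>v n"
  shows "kron_power k x \<noteq> 0\<^sub>v (n ^ k)"
proof (induction k)
  case 0
  have "kron_power 0 x $ 0 = 1" by (simp add: kron_power_def)
  then show ?case by auto
next
  case (Suc k)
  let ?z = "kron_power k x"
  have z: "?z \<in> carrier_vec (n ^ k)" by (rule kron_power_carrier[OF x(1)])
  obtain i where i: "i < n" "x $ i \<noteq> 0"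
    using x by (metis carrier_vecD eq_vecI index_zero_vec)
  obtain j where j: "j < n ^ k" "?z $ j \<noteq> 0"
    using Suc z by (metis carrier_vecD eq_vecI index_zero_vec)
  \<comment> \<open>\<open>j + i * n ^ k\<close> is the index that encodes the pair \<open>(i, j)\<close>\<close>
  have "j + i * n ^ k < n ^ k + i * n ^ k" using j by simp
  also have "\<dots> = Suc i * n ^ k" by simp
  also have "\<dots> \<le> n * n ^ k" using i by (intro mult_le_mono1) simp
  finally have ij: "j + i * n ^ k < n * n ^ k" .
  moreover have "(j + i * n ^ k) div n ^ k = i"
  proof -
    have "n ^ k \<noteq> 0" using j(1) by linarith
    then have "(j + i * n ^ k) div n ^ k = i + j div n ^ k" by (rule div_mult_self1)
    then show ?thesis using div_less[OF j(1)] by simp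
  qed
  ultimately have "kron_power (Suc k) x $ (j + i * n ^ k) = x $ i * ?z $ j"
    using x z j by (simp add: kron_power_Suc kron_vec_def)
  then show ?case using i j ij by auto
qed

section \<open>Operator determinants and Cramer's rule\<close>

text \<open>Each summand of the operator determinant sends a Kronecker power to the Kronecker product of
  the vectors \<open>D i (p i) *\<^sub>v x\<close>, and its entry at \<open>a\<close> is the product of one entry of each of them.
  The sum over the permutations is therefore the Leibniz formula of a scalar matrix.\<close>

lemma op_det_mult_kron_power_index:
  assumes D: "\<And>i j. i < k \<Longrightarrow> j < k \<Longrightarrow> D i j \<in> carrier_mat n n"
    and x: "x \<in> carrier_vec n" and a: "a < n ^ k"
  shows "(op_det k D *\<^sub>v kron_power k x) $ a
    = det (mat k k (\<lambda>(i, j). (D i j *\<^sub>v x) $ (digits n k a ! i)))"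
proof -
  let ?K = "\<lambda>p. kron_mats (map (\<lambda>i. D i (p i)) [0..<k])"
  let ?S = "{p. p permutes {0..<k}}"
  let ?z = "kron_power k x"
  have dim: "(\<Prod>i<k. dim_row (D i 0)) = n ^ k"
  proof -
    have "dim_row (D i 0) = n" if "i < k" for i
      using D[of i 0] that by auto
    then show ?thesis by simp
  qed
  have Dp: "D i (p i) \<in> carrier_mat n n" if "p \<in> ?S" "i < k" for p i
    using that D[of i "p i"] permutes_in_image[of p "{0..<k}" i] by auto
  have Kc: "?K p \<in> carrier_mat (n ^ k) (n ^ k)" if "p \<in> ?S" for p
  proof -
    let ?Ms = "map (\<lambda>i. D i (p i)) [0..<k]"
    have "M \<in> carrier_mat n n" if "M \<in> set ?Ms" for M
      using that Dp[OF \<open>p \<in> ?S\<close>] by auto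
    from kron_mats_carrier[of ?Ms n, OF this] show ?thesis by simp
  qed
  have z: "?z \<in> carrier_vec (n ^ k)" by (rule kron_power_carrier[OF x])
  have Kz: "(?K p *\<^sub>v ?z) $ a = (\<Prod>i<k. (D i (p i) *\<^sub>v x) $ (digits n k a ! i))" if p: "p \<in> ?S" for p
  proof -
    let ?Ms = "map (\<lambda>i. D i (p i)) [0..<k]"
    have Ms: "M \<in> carrier_mat n n" if "M \<in> set ?Ms" for M
      using that Dp[OF p] by auto
    have dim: "dim_vec v = n" if v: "v \<in> set (map (\<lambda>M. M *\<^sub>v x) ?Ms)" for v
    proof -
      obtain i where i: "i < k" "v = D i (p i) *\<^sub>v x" using v by auto
      then show ?thesis using Dp[OF p i(1)] by (simp add: carrier_matD(1)[of _ n n])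
    qed
    have "?K p *\<^sub>v ?z = foldr kron_vec (map (\<lambda>M. M *\<^sub>v x) ?Ms) (vec 1 (\<lambda>_. 1))"
      using kron_mats_mult_kron_power[of ?Ms n x, OF Ms x] by simp
    then show ?thesis
      using conjunct2[OF kron_vecs_index[of "map (\<lambda>M. M *\<^sub>v x) ?Ms" n, OF dim]] a by simp
  qed
  have "(op_det k D *\<^sub>v ?z) $ a = (\<Sum>b<n ^ k. (\<Sum>p\<in>?S. of_int (sign p) * ?K p $$ (a, b)) * ?z $ b)"
    using a z by (auto simp: op_det_def dim scalar_prod_def atLeast0LessThan)
  also have "\<dots> = (\<Sum>p\<in>?S. \<Sum>b<n ^ k. of_int (sign p) * ?K p $$ (a, b) * ?z $ b)"
    unfolding sum_distrib_right by (rule sum.swap)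
  also have "\<dots> = (\<Sum>p\<in>?S. of_int (sign p) * (?K p *\<^sub>v ?z) $ a)"
  proof (rule sum.cong[OF refl])
    fix p assume "p \<in> ?S"
    from Kc[OF this] show "(\<Sum>b<n ^ k. of_int (sign p) * ?K p $$ (a, b) * ?z $ b)
        = of_int (sign p) * (?K p *\<^sub>v ?z) $ a"
      using a z by (auto simp: scalar_prod_def atLeast0LessThan sum_distrib_left mult.assoc intro!: sum.cong)
  qed
  also have "\<dots> = det (mat k k (\<lambda>(i, j). (D i j *\<^sub>v x) $ (digits n k a ! i)))"
  proof -
    have "(\<Prod>i = 0..<k. mat k k (\<lambda>(i, j). (D i j *\<^sub>v x) $ (digits n k a ! i)) $$ (i, p i))
        = (\<Prod>i<k. (D i (p i) *\<^sub>v x) $ (digits n k a ! i))" if "p \<in> ?S" for p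
      using that permutes_in_image[of p "{0..<k}"]
      by (auto simp del: index_mult_mat_vec simp: atLeast0LessThan intro!: prod.cong)
    then show ?thesis
      by (subst det_def'[where n = k]) (simp, intro sum.cong, simp_all only: Kz)
  qed
  finally show ?thesis .
qed

text \<open>The hypothesis says that, in every row, the vector \<open>E i *\<^sub>v x\<close> is the combination of the
  \<open>D i j *\<^sub>v x\<close> with coefficients \<open>\<nu> j\<close> that do not depend on the row. For each entry of the result
  this is a linear system for \<open>\<nu>\<close> with the scalar matrix of the previous lemma, to which Cramer's
  rule applies.\<close>

lemma op_det_cramer:
  assumes D: "\<And>i j. i < k \<Longrightarrow> j < k \<Longrightarrow> D i j \<in> carrier_mat n n"
    and E: "\<And>i. i < k \<Longrightarrow> E i \<in> carrier_mat n n"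
    and x: "x \<in> carrier_vec n" and l: "l < k"
    and eq: "\<And>i d. i < k \<Longrightarrow> d < n \<Longrightarrow> (E i *\<^sub>v x) $ d = (\<Sum>j<k. \<nu> j * (D i j *\<^sub>v x) $ d)"
  shows "op_det k (\<lambda>i j. if j = l then E i else D i j) *\<^sub>v kron_power k x
    = \<nu> l \<cdot>\<^sub>v (op_det k D *\<^sub>v kron_power k x)"
proof (rule eq_vecI)
  let ?D' = "\<lambda>i j. if j = l then E i else D i j"
  have dim: "dim_row (op_det k D) = n ^ k" "dim_row (op_det k ?D') = n ^ k"
  proof -
    have "D i 0 \<in> carrier_mat n n" "?D' i 0 \<in> carrier_mat n n" if "i < k" for i
      using D[of i 0] E[of i] that by auto
    then have "dim_row (D i 0) = n" "dim_row (?D' i 0) = n" if "i < k" for i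
      using that carrier_matD(1) by blast+
    then show "dim_row (op_det k D) = n ^ k" "dim_row (op_det k ?D') = n ^ k"
      using carrier_matD(1)[OF op_det_carrier[of k D n]] carrier_matD(1)[OF op_det_carrier[of k ?D' n]]
      by blast+
  qed
  then show "dim_vec (op_det k ?D' *\<^sub>v kron_power k x) = dim_vec (\<nu> l \<cdot>\<^sub>v (op_det k D *\<^sub>v kron_power k x))"
    by simp
  fix a assume "a < dim_vec (\<nu> l \<cdot>\<^sub>v (op_det k D *\<^sub>v kron_power k x))"
  then have a: "a < n ^ k" using dim by simp
  define W where "W = mat k k (\<lambda>(i, j). (D i j *\<^sub>v x) $ (digits n k a ! i))"
  have W: "W \<in> carrier_mat k k" by (simp add: W_def)
  have We: "W $$ (i, j) = (D i j *\<^sub>v x) $ (digits n k a ! i)" if "i < k" "j < k" for i j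
    using that by (simp add: W_def del: index_mult_mat_vec)
  have d: "digits n k a ! i < n" if "i < k" for i
    using set_digits[OF a] nth_mem[of i "digits n k a"] that by (metis length_digits lessThan_iff subsetD)
  have Wv: "(W *\<^sub>v vec k \<nu>) $ i = (E i *\<^sub>v x) $ (digits n k a ! i)" if "i < k" for i
  proof -
    have "(W *\<^sub>v vec k \<nu>) $ i = (\<Sum>j<k. W $$ (i, j) * \<nu> j)"
      using W that by (simp add: scalar_prod_def atLeast0LessThan)
    also have "\<dots> = (\<Sum>j<k. \<nu> j * (D i j *\<^sub>v x) $ (digits n k a ! i))"
      using that by (intro sum.cong) (simp_all add: We mult.commute del: index_mult_mat_vec)
    finally show ?thesis using eq[OF that d[OF that]] by simp
  qed
  have "mat k k (\<lambda>(i, j). (?D' i j *\<^sub>v x) $ (digits n k a ! i)) = replace_col W (W *\<^sub>v vec k \<nu>) l"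
    using carrier_matD[OF W]
    by (intro eq_matI) (auto simp: replace_col_def Wv We simp del: index_mult_mat_vec)
  then have "det (mat k k (\<lambda>(i, j). (?D' i j *\<^sub>v x) $ (digits n k a ! i))) = \<nu> l * det W"
    using cramer_lemma_mat[OF W, of "vec k \<nu>" l] l by simp
  then show "(op_det k ?D' *\<^sub>v kron_power k x) $ a = (\<nu> l \<cdot>\<^sub>v (op_det k D *\<^sub>v kron_power k x)) $ a"
  proof -
    have D': "?D' i j \<in> carrier_mat n n" if "i < k" "j < k" for i j
      using that D E by simp
    have 1: "(op_det k ?D' *\<^sub>v kron_power k x) $ a
        = det (mat k k (\<lambda>(i, j). (?D' i j *\<^sub>v x) $ (digits n k a ! i)))"
      by (rule op_det_mult_kron_power_index[OF D' x a])
    have 2: "(op_det k D *\<^sub>v kron_power k x) $ a = det W"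
      unfolding W_def by (rule op_det_mult_kron_power_index[OF D x a])
    have "(\<nu> l \<cdot>\<^sub>v (op_det k D *\<^sub>v kron_power k x)) $ a = \<nu> l * (op_det k D *\<^sub>v kron_power k x) $ a"
      using a dim by (intro index_smult_vec) simp
    then show ?thesis
      using \<open>det _ = \<nu> l * det W\<close> by (simp only: 1 2)
  qed
qed


section \<open>The space of symmetric vectors\<close>

text \<open>\<open>N\<close> independent functions on a set of \<open>N\<close> elements form a nonsingular square matrix.\<close>

lemma independent_functions_span:
  fixes u :: "nat \<Rightarrow> 'b \<Rightarrow> complex"
  assumes L: "finite L" "card L = N"
    and ind: "\<And>c. (\<And>l. l \<in> L \<Longrightarrow> (\<Sum>i<N. c i * u i l) = 0) \<Longrightarrow> \<forall>i<N. c i = 0"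
  shows "\<exists>c. \<forall>l\<in>L. w l = (\<Sum>i<N. c i * u i l)"
proof -
  obtain e where e: "bij_betw e {..<N} L"
    using ex_bij_betw_nat_finite[OF L(1)] L(2) by (auto simp: atLeast0LessThan)
  define Z where "Z = mat N N (\<lambda>(a, i). u i (e a))"
  have Z: "Z \<in> carrier_mat N N" by (simp add: Z_def)
  have Zv: "(Z *\<^sub>v v) $ a = (\<Sum>i<N. v $ i * u i (e a))" if "v \<in> carrier_vec N" "a < N" for v a
    using that by (auto simp: Z_def scalar_prod_def atLeast0LessThan mult.commute intro!: sum.cong)
  have "det Z \<noteq> 0"
  proof
    assume "det Z = 0"
    then obtain v where v: "v \<in> carrier_vec N" "v \<noteq> 0\<^sub>v N" "Z *\<^sub>v v = 0\<^sub>v N"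
      using det_0_iff_vec_prod_zero[OF Z] by blast
    have vu: "(\<Sum>i<N. v $ i * u i l) = 0" if "l \<in> L" for l
    proof -
      have "l \<in> e ` {..<N}"
        using that e by (simp add: bij_betw_def)
      then obtain a where a: "a < N" "l = e a" by auto
      show ?thesis
        using Zv[OF v(1) a(1)] a by (simp only: v(3) index_zero_vec)
    qed
    have "\<forall>i<N. v $ i = 0"
      by (rule ind) (rule vu)
    then have "v = 0\<^sub>v N"
      using v(1) by (intro eq_vecI) auto
    then show False using v by blast
  qed
  then obtain Y where Y: "Y \<in> carrier_mat N N" "Z * Y = 1\<^sub>m N"
    using det_non_zero_imp_unit[OF Z, of "()"] by (auto simp: Units_def ring_mat_def)
  define v where "v = Y *\<^sub>v vec N (\<lambda>a. w (e a))"
  have v: "v \<in> carrier_vec N" using Y by (simp add: v_def)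
  have "Z *\<^sub>v v = vec N (\<lambda>a. w (e a))"
    unfolding v_def using Y assoc_mult_mat_vec[OF Z Y(1), of "vec N (\<lambda>a. w (e a))"] by simp
  then have "w (e a) = (\<Sum>i<N. v $ i * u i (e a))" if "a < N" for a
    using Zv[OF v that] that by simp
  then show ?thesis
    using e by (intro exI[of _ "($) v"]) (auto simp: bij_betw_def)
qed

lemma symmetric_vec_iff_lin_comb:
  "symmetric_vec n k z \<longleftrightarrow>
     (\<exists>p (\<alpha> :: nat \<Rightarrow> complex) x. (\<forall>j<p. x j \<in> carrier_vec n) \<and>
        z = lin_comb (n ^ k) {..<p} \<alpha> (\<lambda>j. kron_power k (x j)))"
proof -
  have *: "finsum_vec TYPE(complex) (n ^ k) (\<lambda>j. \<alpha> j \<cdot>\<^sub>v kron_power k (x j)) {..<p}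
      = lin_comb (n ^ k) {..<p} \<alpha> (\<lambda>j. kron_power k (x j))"
    if "\<forall>j<p. x j \<in> carrier_vec n" for p :: nat and \<alpha> :: "nat \<Rightarrow> complex" and x
  proof -
    have c: "(\<lambda>j. \<alpha> j \<cdot>\<^sub>v kron_power k (x j)) \<in> {..<p} \<rightarrow> carrier_vec (n ^ k)"
      using that kron_power_carrier by auto
    have d: "dim_vec (kron_power k (x j)) = n ^ k" if "j < p" for j
      using that kron_power_carrier \<open>\<forall>j<p. x j \<in> carrier_vec n\<close> by (metis carrier_vecD)
    show ?thesis
      using finsum_vec_closed[OF c]
      by (intro eq_vecI) (auto simp: lin_comb_def d index_finsum_vec[OF _ _ c])
  qed
  show ?thesis
    unfolding symmetric_vec_def by (metis (no_types, lifting) *)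
qed

lemma prod_nth_eq_prod_count_list:
  fixes f :: "nat \<Rightarrow> 'c :: comm_monoid_mult"
  assumes "set xs \<subseteq> {..<n}"
  shows "(\<Prod>i<length xs. f (xs ! i)) = (\<Prod>d<n. f d ^ count_list xs d)"
  using assms
proof (induction xs)
  case (Cons y xs)
  have "(\<Prod>d<n. f d ^ count_list (y # xs) d) = (\<Prod>d<n. (if d = y then f d else 1) * f d ^ count_list xs d)"
    by (intro prod.cong) auto
  also have "\<dots> = f y * (\<Prod>d<n. f d ^ count_list xs d)"
    using Cons.prems by (simp add: prod.distrib)
  also have "\<dots> = (\<Prod>i<length (y # xs). f ((y # xs) ! i))"
    using Cons by (simp add: prod.lessThan_Suc_shift del: prod.lessThan_Suc)
  finally show ?case by simp
qed simp

text \<open>The exponent vectors of the monomials of degree \<open>k\<close> in \<open>n\<close> variables.\<close>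

definition exponents :: "nat \<Rightarrow> nat \<Rightarrow> nat list set" where
  "exponents n k = {c. length c = n \<and> sum_list c = k}"

lemma finite_exponents: "finite (exponents n k)"
proof (rule finite_subset)
  show "exponents n k \<subseteq> {c. set c \<subseteq> {..k} \<and> length c = n}"
    by (auto simp: exponents_def dest: member_le_sum_list)
qed (simp add: finite_lists_length_eq)

definition monomial :: "complex vec \<Rightarrow> nat list \<Rightarrow> complex" where
  "monomial x c = (\<Prod>d<length c. x $ d ^ (c ! d))"

lemma kron_power_eq_monomial:
  assumes x: "x \<in> carrier_vec n" and a: "a < n ^ k"
  shows "kron_power k x $ a = monomial x (map (count_list (digits n k a)) [0..<n])"
  using kron_power_index[OF x a] prod_nth_eq_prod_count_list[OF set_digits[OF a], of "\<lambda>d. x $ d"]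
  by (simp add: monomial_def)

lemma digit_counts_exponents:
  assumes "a < n ^ k"
  shows "map (count_list (digits n k a)) [0..<n] \<in> exponents n k"
  using sum_count_set[OF set_digits[OF assms]]
  by (simp add: exponents_def sum_list_distinct_conv_sum_set atLeast0LessThan)

text \<open>An entry of a symmetric vector depends only on how often each digit occurs in its index, that
  is, on an exponent vector. The symmetric vectors thus come from functions on the exponent
  vectors, and independence of the Kronecker powers passes to the functions
  \<open>monomial (x i)\<close>, which then span all functions because there are as many of them as exponent
  vectors.\<close>

lemma independent_kron_powers_span_symmetric:
  assumes N: "card (exponents n k) = N"
    and x: "\<And>i. i < N \<Longrightarrow> x i \<in> carrier_vec n"
    and ind: "\<And>c. lin_comb (n ^ k) {..<N} c (\<lambda>i. kron_power k (x i)) = 0\<^sub>v (n ^ k) \<Longrightarrow> \<forall>i<N. c i = 0"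
    and w: "symmetric_vec n k w"
  shows "\<exists>c. w = lin_comb (n ^ k) {..<N} c (\<lambda>i. kron_power k (x i))"
proof -
  obtain p :: nat and \<alpha> y where y: "\<And>j. j < p \<Longrightarrow> y j \<in> carrier_vec n"
    and w: "w = lin_comb (n ^ k) {..<p} \<alpha> (\<lambda>j. kron_power k (y j))"
    using w unfolding symmetric_vec_iff_lin_comb by blast
  let ?key = "\<lambda>a. map (count_list (digits n k a)) [0..<n]"
  have lc: "lin_comb (n ^ k) {..<q} c (\<lambda>i. kron_power k (v i))
      = vec (n ^ k) (\<lambda>a. \<Sum>i<q. c i * monomial (v i) (?key a))"
    if "\<And>i. i < q \<Longrightarrow> v i \<in> carrier_vec n" for q :: nat and c v
    unfolding lin_comb_def using that by (intro eq_vecI) (auto simp: kron_power_eq_monomial intro!: sum.cong)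
  have lcx: "lin_comb (n ^ k) {..<N} c (\<lambda>i. kron_power k (x i))
      = vec (n ^ k) (\<lambda>a. \<Sum>i<N. c i * monomial (x i) (?key a))" for c
    by (rule lc) (rule x)
  have lcy: "w = vec (n ^ k) (\<lambda>a. \<Sum>j<p. \<alpha> j * monomial (y j) (?key a))"
    unfolding w by (rule lc) (rule y)
  have "\<exists>c. \<forall>l\<in>exponents n k. (\<Sum>j<p. \<alpha> j * monomial (y j) l) = (\<Sum>i<N. c i * monomial (x i) l)"
  proof (rule independent_functions_span[OF finite_exponents N])
    fix c assume c: "\<And>l. l \<in> exponents n k \<Longrightarrow> (\<Sum>i<N. c i * monomial (x i) l) = 0"
    have "lin_comb (n ^ k) {..<N} c (\<lambda>i. kron_power k (x i)) = 0\<^sub>v (n ^ k)"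
      unfolding lcx using digit_counts_exponents by (intro eq_vecI) (simp_all add: c)
    then show "\<forall>i<N. c i = 0" by (rule ind)
  qed
  then obtain c where c: "\<And>l. l \<in> exponents n k \<Longrightarrow>
      (\<Sum>j<p. \<alpha> j * monomial (y j) l) = (\<Sum>i<N. c i * monomial (x i) l)"
    by blast
  have "w = lin_comb (n ^ k) {..<N} c (\<lambda>i. kron_power k (x i))"
    unfolding lcy lcx using digit_counts_exponents by (intro eq_vecI) (simp_all add: c)
  then show ?thesis by blast
qed

section \<open>Solutions of the NEPv as joint eigenvectors\<close>

lemma class_representatives:
  assumes R: "equiv UNIV R" and fin: "finite (S // R)"
  shows "\<exists>h. \<forall>i<card (S // R). h i \<in> S \<and> (\<forall>j<card (S // R). i \<noteq> j \<longrightarrow> (h i, h j) \<notin> R)"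
proof -
  obtain f where f: "bij_betw f {..<card (S // R)} (S // R)"
    using ex_bij_betw_nat_finite[OF fin] by (auto simp: atLeast0LessThan)
  have "\<forall>i<card (S // R). \<exists>p. p \<in> S \<and> f i = R `` {p}"
  proof (intro allI impI)
    fix i assume "i < card (S // R)"
    then have "f i \<in> S // R" using f by (auto simp: bij_betw_def)
    then show "\<exists>p. p \<in> S \<and> f i = R `` {p}" by (auto elim: quotientE)
  qed
  then obtain h where h: "\<And>i. i < card (S // R) \<Longrightarrow> h i \<in> S \<and> f i = R `` {h i}"
    by metis
  have "i = j" if "i < card (S // R)" "j < card (S // R)" "(h i, h j) \<in> R" for i j
  proof -
    have "f i = f j" using h that equiv_class_eq[OF R that(3)] by auto
    then show ?thesis using f that by (auto simp: bij_betw_def inj_on_def)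
  qed
  then show ?thesis using h by blast
qed

lemma equiv_scaling_rel: "equiv UNIV scaling_rel"
proof (rule equivI)
  show "scaling_rel \<subseteq> UNIV \<times> UNIV" by simp
  show "refl scaling_rel"
    by (auto simp: refl_on_def scaling_rel_def intro: exI[of _ 1])
  show "sym scaling_rel"
  proof (rule symI, clarsimp simp: scaling_rel_def)
    fix \<alpha> :: complex and x :: "complex vec"
    assume "\<alpha> \<noteq> 0"
    then show "\<exists>\<beta>. \<beta> \<noteq> 0 \<and> x = \<beta> \<cdot>\<^sub>v (\<alpha> \<cdot>\<^sub>v x)"
      by (intro exI[of _ "1 / \<alpha>"]) (simp add: smult_smult_assoc)
  qed
  show "trans scaling_rel"
  proof (rule transI, clarsimp simp: scaling_rel_def)
    fix \<alpha> \<beta> :: complex and x :: "complex vec"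
    assume "\<alpha> \<noteq> 0" "\<beta> \<noteq> 0"
    then show "\<exists>\<gamma>. \<gamma> \<noteq> 0 \<and> \<beta> \<cdot>\<^sub>v (\<alpha> \<cdot>\<^sub>v x) = \<gamma> \<cdot>\<^sub>v x"
      by (intro exI[of _ "\<beta> * \<alpha>"]) (simp add: smult_smult_assoc)
  qed
qed

text \<open>The eigenvalue tuple of the multiparameter eigenvalue problem that belongs to a solution:
  \<open>\<lambda>\<close> at index \<open>0\<close>, followed by the \<open>m\<close> quotients.\<close>

definition nepv_params ::
    "(nat \<Rightarrow> complex vec) \<Rightarrow> (nat \<Rightarrow> complex vec) \<Rightarrow> complex \<times> complex vec \<Rightarrow> nat \<Rightarrow> complex" where
  "nepv_params r s p j = (if j = 0 then fst p else (r j \<bullet> snd p) / (s j \<bullet> snd p))"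

lemma mult_outer_index:
  "u \<in> carrier_vec n \<Longrightarrow> v \<in> carrier_vec n \<Longrightarrow> x \<in> carrier_vec n \<Longrightarrow> d < n \<Longrightarrow>
    (outer u v *\<^sub>v x) $ d = u $ d * (v \<bullet> x)"
  by (auto simp: outer_def scalar_prod_def sum_distrib_left mult.assoc)

lemma nepv_mat_carrier:
  assumes "A \<in> carrier_mat n n" "B \<in> carrier_mat n n"
  shows "nepv_mat n m A B C r s l x \<in> carrier_mat n n"
  using assms by (simp add: nepv_mat_def)

text \<open>The coefficient vector \<open>x\<close> and the vector \<open>y\<close> to which the matrix is applied are kept apart,
  since the matrix depends on \<open>x\<close> only through the quotients.\<close>

lemma nepv_mat_mult_index:
  assumes A: "A \<in> carrier_mat n n" and B: "B \<in> carrier_mat n n"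
    and C: "\<And>i. i \<in> {1..m} \<Longrightarrow> C i \<in> carrier_mat n n"
    and y: "y \<in> carrier_vec n" and d: "d < n"
  shows "(nepv_mat n m A B C r s l x *\<^sub>v y) $ d
    = (A *\<^sub>v y) $ d + l * (B *\<^sub>v y) $ d + (\<Sum>i\<in>{1..m}. (r i \<bullet> x) / (s i \<bullet> x) * (C i *\<^sub>v y) $ d)"
proof -
  have Mz: "(M *\<^sub>v y) $ d = (\<Sum>c<n. M $$ (d, c) * y $ c)" if "M \<in> carrier_mat n n" for M
    using that d y by (simp add: scalar_prod_def atLeast0LessThan)
  have Ci: "(((r i \<bullet> x) / (s i \<bullet> x)) \<cdot>\<^sub>m C i) $$ (d, c) = (r i \<bullet> x) / (s i \<bullet> x) * C i $$ (d, c)"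
    if "i \<in> {1..m}" "c < n" for i c
    using C[OF that(1)] that d by auto
  have "(nepv_mat n m A B C r s l x *\<^sub>v y) $ d
      = (\<Sum>c<n. (A $$ (d, c) + l * B $$ (d, c) + (\<Sum>i\<in>{1..m}. (r i \<bullet> x) / (s i \<bullet> x) * C i $$ (d, c))) * y $ c)"
    unfolding Mz[OF nepv_mat_carrier[OF A B]]
  proof (rule sum.cong[OF refl])
    fix c assume "c \<in> {..<n}"
    then show "nepv_mat n m A B C r s l x $$ (d, c) * y $ c
        = (A $$ (d, c) + l * B $$ (d, c) + (\<Sum>i\<in>{1..m}. (r i \<bullet> x) / (s i \<bullet> x) * C i $$ (d, c))) * y $ c"
      using A B d Ci by (simp add: nepv_mat_def)
  qed
  also have "\<dots> = (\<Sum>c<n. A $$ (d, c) * y $ c) + l * (\<Sum>c<n. B $$ (d, c) * y $ c)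
      + (\<Sum>c<n. \<Sum>i\<in>{1..m}. (r i \<bullet> x) / (s i \<bullet> x) * (C i $$ (d, c) * y $ c))"
    by (simp add: distrib_right sum.distrib sum_distrib_left sum_distrib_right mult.assoc)
  also have "\<dots> = (\<Sum>c<n. A $$ (d, c) * y $ c) + l * (\<Sum>c<n. B $$ (d, c) * y $ c)
      + (\<Sum>i\<in>{1..m}. (r i \<bullet> x) / (s i \<bullet> x) * (\<Sum>c<n. C i $$ (d, c) * y $ c))"
    by (subst sum.swap) (simp add: sum_distrib_left)
  also have "\<dots> = (A *\<^sub>v y) $ d + l * (B *\<^sub>v y) $ d + (\<Sum>i\<in>{1..m}. (r i \<bullet> x) / (s i \<bullet> x) * (C i *\<^sub>v y) $ d)"
    using Mz C A B by (simp del: index_mult_mat_vec)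
  finally show ?thesis .
qed

text \<open>In row \<open>i \<ge> 1\<close> of the multiparameter problem the two rank one terms cancel, because
  \<open>(r i \<bullet> x) = \<nu> i * (s i \<bullet> x)\<close>; what remains in each row is the NEPv itself.\<close>

lemma nepv_solution_row_equation:
  assumes A: "A \<in> carrier_mat n n" and B: "B \<in> carrier_mat n n"
    and C: "\<And>i. i \<in> {1..m} \<Longrightarrow> C i \<in> carrier_mat n n"
    and r: "\<And>i. i \<in> {1..m} \<Longrightarrow> r i \<in> carrier_vec n"
    and s: "\<And>i. i \<in> {1..m} \<Longrightarrow> s i \<in> carrier_vec n"
    and g: "\<And>i. i \<in> {1..m} \<Longrightarrow> g i \<in> carrier_vec n"
    and p: "p \<in> nepv_solutions n m A B C r s" and i: "i \<le> m" and d: "d < n"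
  shows "(Delta1_array A B C g r s i 0 *\<^sub>v snd p) $ d
    = (\<Sum>j<m + 1. nepv_params r s p j * (Delta0_array B C g s i j *\<^sub>v snd p) $ d)"
proof -
  obtain l x where p_eq: "p = (l, x)" by (cases p)
  have x: "x \<in> carrier_vec n" and sx: "\<And>i. i \<in> {1..m} \<Longrightarrow> s i \<bullet> x \<noteq> 0"
    and sol: "nepv_mat n m A B C r s l x *\<^sub>v x = 0\<^sub>v n"
    using p by (auto simp: p_eq nepv_solutions_def)
  \<comment> \<open>the contribution of the rank one term, which occurs on the diagonal only\<close>
  define G where "G = (\<lambda>j. if i = j then g j $ d * (s j \<bullet> x) else 0)"
  have Dj: "(Delta0_array B C g s i j *\<^sub>v x) $ d = (C j *\<^sub>v x) $ d - G j" if j: "j \<in> {1..m}" for j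
  proof (cases "i = j")
    case True
    have o: "outer (g j) (s j) \<in> carrier_mat n n" using g[OF j] s[OF j] by (simp add: outer_def)
    have "((C j - outer (g j) (s j)) *\<^sub>v x) $ d = (C j *\<^sub>v x - outer (g j) (s j) *\<^sub>v x) $ d"
      by (simp only: minus_mult_distrib_mat_vec[OF C[OF j] o x])
    also have "\<dots> = (C j *\<^sub>v x) $ d - (outer (g j) (s j) *\<^sub>v x) $ d"
      using o d by (intro index_minus_vec) simp
    finally show ?thesis
      using True j by (simp add: Delta0_array_def G_def mult_outer_index[OF g[OF j] s[OF j] x d] del: index_mult_mat_vec)
  next
    case False
    then show ?thesis using j by (simp add: Delta0_array_def G_def del: index_mult_mat_vec)
  qed
  have uminus: "(- M *\<^sub>v x) $ d = - (M *\<^sub>v x) $ d" if "M \<in> carrier_mat n n" for M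
    using that x d by (simp add: scalar_prod_def sum_negf)
  have split: "{..<m + 1} = insert 0 {1..m}" by auto
  have "(\<Sum>j<m + 1. nepv_params r s p j * (Delta0_array B C g s i j *\<^sub>v snd p) $ d)
      = l * (B *\<^sub>v x) $ d + (\<Sum>j\<in>{1..m}. (r j \<bullet> x) / (s j \<bullet> x) * ((C j *\<^sub>v x) $ d - G j))"
    unfolding split
    by (subst sum.insert) (simp_all add: Dj nepv_params_def p_eq del: index_mult_mat_vec add: Delta0_array_def[of _ _ _ _ _ 0])
  also have "\<dots> = l * (B *\<^sub>v x) $ d + (\<Sum>j\<in>{1..m}. (r j \<bullet> x) / (s j \<bullet> x) * (C j *\<^sub>v x) $ d)
      - (\<Sum>j\<in>{1..m}. (r j \<bullet> x) / (s j \<bullet> x) * G j)"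
    by (simp add: right_diff_distrib sum_subtractf del: index_mult_mat_vec)
  also have "\<dots> = - (A *\<^sub>v x) $ d - (\<Sum>j\<in>{1..m}. (r j \<bullet> x) / (s j \<bullet> x) * G j)"
  proof -
    have "(nepv_mat n m A B C r s l x *\<^sub>v x) $ d = 0" unfolding sol using d by simp
    then have "(A *\<^sub>v x) $ d + l * (B *\<^sub>v x) $ d + (\<Sum>i\<in>{1..m}. (r i \<bullet> x) / (s i \<bullet> x) * (C i *\<^sub>v x) $ d) = 0"
      by (subst (asm) nepv_mat_mult_index[OF A B C x d])
    then have "l * (B *\<^sub>v x) $ d + (\<Sum>i\<in>{1..m}. (r i \<bullet> x) / (s i \<bullet> x) * (C i *\<^sub>v x) $ d) = - (A *\<^sub>v x) $ d"
      by (simp add: eq_neg_iff_add_eq_0 add_ac del: index_mult_mat_vec)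
    then show ?thesis by (simp only:)
  qed
  also have "(\<Sum>j\<in>{1..m}. (r j \<bullet> x) / (s j \<bullet> x) * G j) = (if i = 0 then 0 else g i $ d * (r i \<bullet> x))"
  proof -
    have "(\<Sum>j\<in>{1..m}. (r j \<bullet> x) / (s j \<bullet> x) * G j) = (\<Sum>j\<in>{1..m}. if i = j then g i $ d * (r i \<bullet> x) else 0)"
      using sx by (intro sum.cong) (auto simp: G_def)
    then show ?thesis using i by auto
  qed
  also have "- (A *\<^sub>v x) $ d - (if i = 0 then 0 else g i $ d * (r i \<bullet> x))
      = (Delta1_array A B C g r s i 0 *\<^sub>v x) $ d"
  proof (cases "i = 0")
    case True
    then show ?thesis
      using uminus[OF A] by (simp add: Delta1_array_def del: index_mult_mat_vec)
  next
    case False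
    then have i1: "i \<in> {1..m}" using i by simp
    have o: "outer (g i) (r i) \<in> carrier_mat n n" using g[OF i1] r[OF i1] by (simp add: outer_def)
    have M: "A + outer (g i) (r i) \<in> carrier_mat n n" using A o by simp
    have "(- (A + outer (g i) (r i)) *\<^sub>v x) $ d = - ((A + outer (g i) (r i)) *\<^sub>v x) $ d"
      by (rule uminus[OF M])
    also have "\<dots> = - ((A *\<^sub>v x) $ d + (outer (g i) (r i) *\<^sub>v x) $ d)"
      unfolding add_mult_distrib_mat_vec[OF A o x] using o d by (subst index_add_vec) simp_all
    also have "\<dots> = - ((A *\<^sub>v x) $ d + g i $ d * (r i \<bullet> x))"
      by (simp only: mult_outer_index[OF g[OF i1] r[OF i1] x d])
    finally show ?thesis using False by (simp add: Delta1_array_def del: index_mult_mat_vec)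
  qed
  finally show ?thesis by (simp add: p_eq del: index_mult_mat_vec)
qed

text \<open>The numerators of Cramer's rule for the \<open>m + 1\<close> parameters of the multiparameter problem,
  with \<open>\<Delta>\<^sub>0\<close> as their common denominator.\<close>

definition Delta :: "nat \<Rightarrow> complex mat \<Rightarrow> complex mat \<Rightarrow> (nat \<Rightarrow> complex mat) \<Rightarrow>
    (nat \<Rightarrow> complex vec) \<Rightarrow> (nat \<Rightarrow> complex vec) \<Rightarrow> (nat \<Rightarrow> complex vec) \<Rightarrow> nat \<Rightarrow> complex mat" where
  "Delta m A B C g r s l = op_det (m + 1)
     (\<lambda>i j. if j = l then Delta1_array A B C g r s i 0 else Delta0_array B C g s i j)"

lemma Delta_0_eq_Delta1: "Delta m A B C g r s 0 = Delta1 m A B C g r s"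
  unfolding Delta_def Delta1_def
  by (rule arg_cong[where f = "op_det (m + 1)"]) (auto simp: Delta1_array_def fun_eq_iff)

lemma Delta_arrays_carrier:
  assumes "A \<in> carrier_mat n n" "B \<in> carrier_mat n n"
    and "\<And>i. i \<in> {1..m} \<Longrightarrow> C i \<in> carrier_mat n n"
    and "\<And>i. i \<in> {1..m} \<Longrightarrow> r i \<in> carrier_vec n"
    and "\<And>i. i \<in> {1..m} \<Longrightarrow> s i \<in> carrier_vec n"
    and "\<And>i. i \<in> {1..m} \<Longrightarrow> g i \<in> carrier_vec n"
    and "i < m + 1" "j < m + 1"
  shows "Delta1_array A B C g r s i 0 \<in> carrier_mat n n" "Delta0_array B C g s i j \<in> carrier_mat n n"
proof -
  have o: "outer (g i) v \<in> carrier_mat n n" if "i \<in> {1..m}" "v \<in> carrier_vec n" for v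
    using assms(6)[OF that(1)] that(2) by (simp add: outer_def)
  show "Delta1_array A B C g r s i 0 \<in> carrier_mat n n"
    using assms(1,4,7) o by (auto simp: Delta1_array_def)
  show "Delta0_array B C g s i j \<in> carrier_mat n n"
    using assms(2,3,5,7,8) o by (auto simp: Delta0_array_def intro!: minus_carrier_mat)
qed

lemma nepv_solution_Delta_eigenvector:
  assumes A: "A \<in> carrier_mat n n" and B: "B \<in> carrier_mat n n"
    and C: "\<And>i. i \<in> {1..m} \<Longrightarrow> C i \<in> carrier_mat n n"
    and r: "\<And>i. i \<in> {1..m} \<Longrightarrow> r i \<in> carrier_vec n"
    and s: "\<And>i. i \<in> {1..m} \<Longrightarrow> s i \<in> carrier_vec n"
    and g: "\<And>i. i \<in> {1..m} \<Longrightarrow> g i \<in> carrier_vec n"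
    and p: "p \<in> nepv_solutions n m A B C r s" and l: "l \<le> m"
  shows "Delta m A B C g r s l *\<^sub>v kron_power (m + 1) (snd p)
    = nepv_params r s p l \<cdot>\<^sub>v (Delta0 m B C g s *\<^sub>v kron_power (m + 1) (snd p))"
  unfolding Delta_def Delta0_def
proof (rule op_det_cramer)
  show "snd p \<in> carrier_vec n" using p by (auto simp: nepv_solutions_def)
  show "l < m + 1" using l by simp
  show "Delta0_array B C g s i j \<in> carrier_mat n n" if "i < m + 1" "j < m + 1" for i j
    by (rule Delta_arrays_carrier(2)[OF A B C r s g that])
  show "Delta1_array A B C g r s i 0 \<in> carrier_mat n n" if "i < m + 1" for i
    by (rule Delta_arrays_carrier(1)[OF A B C r s g that that])
  fix i d assume i: "i < m + 1" and d: "d < n"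
  then have "i \<le> m" by simp
  from nepv_solution_row_equation[OF A B C r s g p this d]
  show "(Delta1_array A B C g r s i 0 *\<^sub>v snd p) $ d
      = (\<Sum>j<m + 1. nepv_params r s p j * (Delta0_array B C g s i j *\<^sub>v snd p) $ d)" .
qed

text \<open>If two inequivalent solutions had the same parameters, then \<open>x + t x'\<close> would have these
  parameters as well for every \<open>t\<close> for which the denominators do not vanish, and the NEPv matrix
  would be the same at all these vectors. So they would all be solutions, for all but
  finitely many \<open>t\<close>, and pairwise inequivalent.\<close>

lemma nepv_params_separate_solutions:
  assumes A: "A \<in> carrier_mat n n" and B: "B \<in> carrier_mat n n"
    and C: "\<And>i. i \<in> {1..m} \<Longrightarrow> C i \<in> carrier_mat n n"
    and r: "\<And>i. i \<in> {1..m} \<Longrightarrow> r i \<in> carrier_vec n"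
    and s: "\<And>i. i \<in> {1..m} \<Longrightarrow> s i \<in> carrier_vec n"
    and fin: "finite (nepv_solutions n m A B C r s // scaling_rel)"
    and p: "p \<in> nepv_solutions n m A B C r s" and p': "p' \<in> nepv_solutions n m A B C r s"
    and unrelated: "(p, p') \<notin> scaling_rel"
  shows "\<exists>j\<le>m. nepv_params r s p j \<noteq> nepv_params r s p' j"
proof (rule ccontr)
  assume "\<not> ?thesis"
  then have eq: "nepv_params r s p j = nepv_params r s p' j" if "j \<le> m" for j
    using that by blast
  obtain l x where p_eq: "p = (l, x)" by (cases p)
  obtain x' where p'_eq: "p' = (l, x')"
    using eq[of 0] by (cases p') (simp add: nepv_params_def p_eq)
  have x: "x \<in> carrier_vec n" "x \<noteq> 0\<^sub>v n" and sx: "\<And>i. i \<in> {1..m} \<Longrightarrow> s i \<bullet> x \<noteq> 0"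
    and sol: "nepv_mat n m A B C r s l x *\<^sub>v x = 0\<^sub>v n"
    using p by (auto simp: p_eq nepv_solutions_def)
  have x': "x' \<in> carrier_vec n" "x' \<noteq> 0\<^sub>v n" and sx': "\<And>i. i \<in> {1..m} \<Longrightarrow> s i \<bullet> x' \<noteq> 0"
    and sol': "nepv_mat n m A B C r s l x' *\<^sub>v x' = 0\<^sub>v n"
    using p' by (auto simp: p'_eq nepv_solutions_def)
  have \<mu>: "(r i \<bullet> x) / (s i \<bullet> x) = (r i \<bullet> x') / (s i \<bullet> x')" if "i \<in> {1..m}" for i
    using eq[of i] that by (simp add: nepv_params_def p_eq p'_eq)
  have indep: "x' \<noteq> \<alpha> \<cdot>\<^sub>v x" for \<alpha>
  proof
    assume "x' = \<alpha> \<cdot>\<^sub>v x"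
    moreover from this have "\<alpha> \<noteq> 0" using x x' by auto
    ultimately show False using unrelated by (auto simp: scaling_rel_def p_eq p'_eq)
  qed
  have coeff_zero: "b = 0" if "a \<cdot>\<^sub>v x + b \<cdot>\<^sub>v x' = 0\<^sub>v n" for a b
  proof (rule ccontr)
    assume b: "b \<noteq> 0"
    have "x' = (- a / b) \<cdot>\<^sub>v x"
    proof (rule eq_vecI)
      fix d assume "d < dim_vec ((- a / b) \<cdot>\<^sub>v x)"
      then have d: "d < n" using x by simp
      then have "a * x $ d + b * x' $ d = 0"
        using arg_cong[OF that, of "\<lambda>v. v $ d"] x x' by simp
      then have "b * x' $ d = - a * x $ d"
        by (simp add: eq_neg_iff_add_eq_0 add.commute)
      then show "x' $ d = ((- a / b) \<cdot>\<^sub>v x) $ d"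
        using b x d by (simp add: field_simps)
    qed (use x x' in simp)
    then show False using indep by blast
  qed
  define y where "y t = x + t \<cdot>\<^sub>v x'" for t
  have y: "y t \<in> carrier_vec n" for t using x x' by (simp add: y_def)
  have lin: "v \<bullet> y t = v \<bullet> x + t * (v \<bullet> x')" if "v \<in> carrier_vec n" for v t
    using that x x' by (simp add: y_def scalar_prod_add_distrib)
  \<comment> \<open>each denominator vanishes for at most one \<open>t\<close>, as \<open>s i \<bullet> x' \<noteq> 0\<close>\<close>
  define T where "T = {t. \<forall>i\<in>{1..m}. s i \<bullet> y t \<noteq> 0}"
  have "- T \<subseteq> (\<Union>i\<in>{1..m}. {- (s i \<bullet> x) / (s i \<bullet> x')})"
  proof
    fix t assume "t \<in> - T"
    then obtain i where i: "i \<in> {1..m}" "s i \<bullet> x + t * (s i \<bullet> x') = 0"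
      using lin s by (auto simp: T_def)
    then have "t = - (s i \<bullet> x) / (s i \<bullet> x')"
      using sx'[OF i(1)] by (simp add: field_simps add_eq_0_iff2)
    then show "t \<in> (\<Union>i\<in>{1..m}. {- (s i \<bullet> x) / (s i \<bullet> x')})" using i by blast
  qed
  then have "finite (- T)" by (rule finite_subset) simp
  then have infT: "infinite T"
    using infinite_UNIV_char_0[where 'a = complex] by (metis Compl_partition finite_UnI)
  have solT: "(l, y t) \<in> nepv_solutions n m A B C r s" if t: "t \<in> T" for t
  proof -
    have st: "s i \<bullet> y t \<noteq> 0" if "i \<in> {1..m}" for i using t that by (simp add: T_def)
    have \<mu>t: "(r i \<bullet> y t) / (s i \<bullet> y t) = (r i \<bullet> x) / (s i \<bullet> x)" if i: "i \<in> {1..m}" for i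
    proof -
      let ?\<mu> = "(r i \<bullet> x) / (s i \<bullet> x)"
      have "r i \<bullet> x = ?\<mu> * (s i \<bullet> x)" using sx[OF i] by simp
      moreover have "r i \<bullet> x' = ?\<mu> * (s i \<bullet> x')" using \<mu>[OF i] sx'[OF i] by simp
      ultimately have "r i \<bullet> y t = ?\<mu> * (s i \<bullet> y t)"
        unfolding lin[OF r[OF i]] lin[OF s[OF i]] by (simp only: distrib_left mult.left_commute)
      then show ?thesis using st[OF i] by simp
    qed
    have "y t \<noteq> 0\<^sub>v n"
    proof
      assume y0: "y t = 0\<^sub>v n"
      then have "1 \<cdot>\<^sub>v x + t \<cdot>\<^sub>v x' = 0\<^sub>v n" by (simp add: y_def)
      then have "t = 0" by (rule coeff_zero)
      then have "y t = x" using x x' unfolding y_def by (intro eq_vecI) auto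
      then have "x = 0\<^sub>v n" using y0 by simp
      then show False using x by simp
    qed
    moreover have "nepv_mat n m A B C r s l (y t) *\<^sub>v y t = 0\<^sub>v n"
    proof (rule eq_vecI)
      fix d assume "d < dim_vec (0\<^sub>v n :: complex vec)"
      then have d: "d < n" by simp
      have same: "(nepv_mat n m A B C r s l w *\<^sub>v v) $ d = (nepv_mat n m A B C r s l x *\<^sub>v v) $ d"
        if "v \<in> carrier_vec n" "\<And>i. i \<in> {1..m} \<Longrightarrow> (r i \<bullet> w) / (s i \<bullet> w) = (r i \<bullet> x) / (s i \<bullet> x)" for v w
      proof -
        have "(nepv_mat n m A B C r s l u *\<^sub>v v) $ d
            = (A *\<^sub>v v) $ d + l * (B *\<^sub>v v) $ d + (\<Sum>i\<in>{1..m}. (r i \<bullet> u) / (s i \<bullet> u) * (C i *\<^sub>v v) $ d)" for u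
          by (rule nepv_mat_mult_index[OF A B C that(1) d])
        then show ?thesis by (simp only: that(2) cong: sum.cong)
      qed
      have M: "nepv_mat n m A B C r s l x \<in> carrier_mat n n" by (rule nepv_mat_carrier[OF A B])
      have "(nepv_mat n m A B C r s l (y t) *\<^sub>v y t) $ d = (nepv_mat n m A B C r s l x *\<^sub>v y t) $ d"
        by (rule same[OF y \<mu>t])
      also have "\<dots> = (nepv_mat n m A B C r s l x *\<^sub>v x) $ d + t * (nepv_mat n m A B C r s l x *\<^sub>v x') $ d"
      proof -
        have "row (nepv_mat n m A B C r s l x) d \<in> carrier_vec n"
          by (rule row_carrier_vec[OF d M])
        then show ?thesis using lin[of "row (nepv_mat n m A B C r s l x) d" t] M d by simp
      qed
      also have "\<dots> = 0"
        using same[OF x'(1), of x'] \<mu> d by (simp add: sol sol' del: index_mult_mat_vec)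
      finally show "(nepv_mat n m A B C r s l (y t) *\<^sub>v y t) $ d = 0\<^sub>v n $ d" using d by simp
    qed (use carrier_matD(1)[OF nepv_mat_carrier[OF A B]] in simp)
    ultimately show ?thesis using y st by (simp add: nepv_solutions_def)
  qed
  have "inj_on (\<lambda>t. scaling_rel `` {(l, y t)}) T"
  proof (rule inj_onI)
    fix t u assume "scaling_rel `` {(l, y t)} = scaling_rel `` {(l, y u)}"
    then have "((l, y t), (l, y u)) \<in> scaling_rel"
      using eq_equiv_class[OF _ equiv_scaling_rel] by blast
    then obtain \<alpha> where \<alpha>: "\<alpha> \<noteq> 0" "y u = \<alpha> \<cdot>\<^sub>v y t" by (auto simp: scaling_rel_def)
    have e: "(1 - \<alpha>) * x $ d + (u - \<alpha> * t) * x' $ d = 0" if "d < n" for d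
      using arg_cong[OF \<alpha>(2), of "\<lambda>v. v $ d"] x x' that by (simp add: y_def algebra_simps)
    have "(1 - \<alpha>) \<cdot>\<^sub>v x + (u - \<alpha> * t) \<cdot>\<^sub>v x' = 0\<^sub>v n"
      using e x x' by (intro eq_vecI) auto
    then have u: "u - \<alpha> * t = 0" by (rule coeff_zero)
    obtain d where "d < n" "x $ d \<noteq> 0"
      using x by (metis carrier_vecD eq_vecI index_zero_vec)
    then have "\<alpha> = 1" using e[of d] u by simp
    then show "t = u" using u by simp
  qed
  moreover have "(\<lambda>t. scaling_rel `` {(l, y t)}) ` T \<subseteq> nepv_solutions n m A B C r s // scaling_rel"
    using solT by (auto intro: quotientI)
  ultimately show False
    using fin infT by (meson finite_subset inj_on_finite)
qed

theorem theorem4p7: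
  fixes n m N :: nat
    and A B :: "complex mat"
    and C :: "nat \<Rightarrow> complex mat"
    and r s g :: "nat \<Rightarrow> complex vec"
    and D0 D1 :: "complex mat"
    and \<sigma> :: complex
    and zk zt zk1 :: "complex vec"
  assumes A: "A \<in> carrier_mat n n"
    and B: "B \<in> carrier_mat n n"
    and C: "\<And>i. i \<in> {1..m} \<Longrightarrow> C i \<in> carrier_mat n n"
    and r: "\<And>i. i \<in> {1..m} \<Longrightarrow> r i \<in> carrier_vec n"
    and s: "\<And>i. i \<in> {1..m} \<Longrightarrow> s i \<in> carrier_vec n"
    and g: "\<And>i. i \<in> {1..m} \<Longrightarrow> g i \<in> carrier_vec n \<and> g i \<noteq> 0\<^sub>v n"
    and N: "N = n ^ (m + 1)"
    and D0: "D0 = Delta0 m B C g s"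
    and D1: "D1 = Delta1 m A B C g r s"
    and solutions:
      "finite (nepv_solutions n m A B C r s // scaling_rel)"
      "card (nepv_solutions n m A B C r s // scaling_rel) = (n + m) choose (m + 1)"
    and regular: "regular_pencil D1 D0"
    and nondefective: "nondefective_pencil N D1 D0"
    and shift: "\<not> pencil_eigenvalue N D1 D0 \<sigma>"
    and zk: "zk \<in> carrier_vec N" "zk \<noteq> 0\<^sub>v N"
    and zt: "zt \<in> carrier_vec N" "(D1 - \<sigma> \<cdot>\<^sub>m D0) *\<^sub>v zt = D0 *\<^sub>v zk"
    and zk1: "zk1 = complex_of_real (1 / vec_norm zt) \<cdot>\<^sub>v zt"
    and sym: "symmetric_vec n (m + 1) zk"
  shows "symmetric_vec n (m + 1) zk1"
proof -
  define Ns where "Ns = (n + m) choose (m + 1)"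
  let ?S = "nepv_solutions n m A B C r s"
  have gc: "g i \<in> carrier_vec n" if "i \<in> {1..m}" for i using g[OF that] by simp
  have D0c: "D0 \<in> carrier_mat N N" unfolding D0 N by (rule Delta0_carrier[OF B])
  have D1c: "D1 \<in> carrier_mat N N" unfolding D1 N by (rule Delta1_carrier[OF A gc])
  obtain h where h: "\<And>i. i < Ns \<Longrightarrow> h i \<in> ?S"
    and hd: "\<And>i j. i < Ns \<Longrightarrow> j < Ns \<Longrightarrow> i \<noteq> j \<Longrightarrow> (h i, h j) \<notin> scaling_rel"
    using class_representatives[OF equiv_scaling_rel solutions(1)] unfolding solutions(2) Ns_def by blast
  define z where "z i = kron_power (m + 1) (snd (h i))" for i
  define \<nu> where "\<nu> i = nepv_params r s (h i)" for i
  have hx: "snd (h i) \<in> carrier_vec n" "snd (h i) \<noteq> 0\<^sub>v n" if "i < Ns" for i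
    using h[OF that] by (auto simp: nepv_solutions_def)
  have z: "z i \<in> carrier_vec N" "z i \<noteq> 0\<^sub>v N" if "i < Ns" for i
    unfolding z_def N by (rule kron_power_carrier[OF hx(1)[OF that]], rule kron_power_nonzero[OF hx[OF that]])
  have ev: "Delta m A B C g r s j *\<^sub>v z i = \<nu> i j \<cdot>\<^sub>v (D0 *\<^sub>v z i)" if "i < Ns" "j \<le> m" for i j
    unfolding z_def \<nu>_def D0 by (rule nepv_solution_Delta_eigenvector[OF A B C r s gc h[OF that(1)] that(2)])
  have ev1: "D1 *\<^sub>v z i = \<nu> i 0 \<cdot>\<^sub>v (D0 *\<^sub>v z i)" if "i < Ns" for i
    using ev[OF that, of 0] by (simp add: Delta_0_eq_Delta1 D1)
  have dist: "\<exists>j\<le>m. \<nu> i j \<noteq> \<nu> i' j" if "i < Ns" "i' < Ns" "i \<noteq> i'" for i i'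
    unfolding \<nu>_def
    by (rule nepv_params_separate_solutions[OF A B C r s solutions(1) h[OF that(1)] h[OF that(2)] hd[OF that]])
  obtain t where t: "det (D1 - t \<cdot>\<^sub>m D0) \<noteq> 0"
    using regular unfolding regular_pencil_def by blast
  have Dc: "Delta m A B C g r s j \<in> carrier_mat N N" for j
    unfolding Delta_def N
  proof (rule op_det_carrier)
    fix i assume i: "i < m + 1"
    have "Delta1_array A B C g r s i 0 \<in> carrier_mat n n"
      by (rule Delta_arrays_carrier(1)[OF A B C r s gc i i])
    moreover have "Delta0_array B C g s i 0 \<in> carrier_mat n n"
      by (rule Delta_arrays_carrier(2)[OF A B C r s gc i]) simp_all
    ultimately show "dim_row (if 0 = j then Delta1_array A B C g r s i 0 else Delta0_array B C g s i 0) = n"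
      by simp
  qed
  have ind: "\<forall>i<Ns. c i = 0" if "lin_comb N {..<Ns} c z = 0\<^sub>v N" for c
  proof -
    have "\<forall>i\<in>{..<Ns}. c i = 0"
      by (rule joint_eigenvectors_independent[where D = D0 and \<Delta> = "Delta m A B C g r s" and m = m and t = t
            and z = z and \<nu> = \<nu>, OF D0c Dc])
        (use t z ev dist that in \<open>auto simp: Delta_0_eq_Delta1 D1\<close>)
    then show ?thesis by simp
  qed
  have card: "card (exponents n (m + 1)) = Ns"
    by (simp add: exponents_def card_length_sum_list Ns_def add.commute)
  have "\<exists>c. zk = lin_comb N {..<Ns} c z"
    unfolding z_def N
    by (rule independent_kron_powers_span_symmetric[OF card hx(1) _ sym]) (auto intro: ind[unfolded z_def N, rule_format])
  then obtain c where c: "zk = lin_comb N {..<Ns} c z" by blast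
  have \<sigma>: "\<nu> i 0 \<noteq> \<sigma>" if "i < Ns" for i
    using shift ev1[OF that] z[OF that] by (auto simp: pencil_eigenvalue_def pencil_eigenvector_def)
  let ?M = "D1 - \<sigma> \<cdot>\<^sub>m D0"
  have M: "?M \<in> carrier_mat N N" using D0c by (intro minus_carrier_mat) simp
  have Mv: "?M *\<^sub>v v = D1 *\<^sub>v v - \<sigma> \<cdot>\<^sub>v (D0 *\<^sub>v v)" if "v \<in> carrier_vec N" for v
  proof -
    have "(\<sigma> \<cdot>\<^sub>m D0) *\<^sub>v v = \<sigma> \<cdot>\<^sub>v (D0 *\<^sub>v v)"
      using D0c that by (intro eq_vecI) (simp_all add: scalar_prod_def sum_distrib_left mult.assoc)
    moreover have "\<sigma> \<cdot>\<^sub>m D0 \<in> carrier_mat N N" using D0c by simp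
    ultimately show ?thesis using minus_mult_distrib_mat_vec[OF D1c _ that] by metis
  qed
  \<comment> \<open>on the eigenvector \<open>z i\<close>, the step divides by \<open>\<nu> i 0 - \<sigma>\<close>\<close>
  define b where "b i = c i / (\<nu> i 0 - \<sigma>)" for i
  have "?M *\<^sub>v lin_comb N {..<Ns} b z = lin_comb N {..<Ns} b (\<lambda>i. ?M *\<^sub>v z i)"
    by (rule mult_mat_vec_lin_comb[OF M]) (use z in auto)
  also have "\<dots> = lin_comb N {..<Ns} c (\<lambda>i. D0 *\<^sub>v z i)"
  proof (rule lin_comb_cong)
    fix i assume "i \<in> {..<Ns}"
    then have i: "i < Ns" by simp
    have w: "D0 *\<^sub>v z i \<in> carrier_vec N" using D0c z[OF i] by simp
    show "?M *\<^sub>v z i \<in> carrier_vec N \<and> D0 *\<^sub>v z i \<in> carrier_vec N" using M w z[OF i] by simp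
    have "?M *\<^sub>v z i = (\<nu> i 0 - \<sigma>) \<cdot>\<^sub>v (D0 *\<^sub>v z i)"
      unfolding Mv[OF z(1)[OF i]] ev1[OF i] using w by (intro eq_vecI) (auto simp: algebra_simps simp del: index_mult_mat_vec)
    then show "b i \<cdot>\<^sub>v (?M *\<^sub>v z i) = c i \<cdot>\<^sub>v (D0 *\<^sub>v z i)"
      using \<sigma>[OF i] by (simp add: smult_smult_assoc b_def)
  qed
  also have "\<dots> = D0 *\<^sub>v zk"
    unfolding c by (rule mult_mat_vec_lin_comb[OF D0c, symmetric]) (use z in auto)
  finally have sol: "?M *\<^sub>v lin_comb N {..<Ns} b z = D0 *\<^sub>v zk" .
  define v where "v = zt - lin_comb N {..<Ns} b z"
  have v: "v \<in> carrier_vec N" using zt(1) by (simp add: v_def)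
  have "?M *\<^sub>v v = D0 *\<^sub>v zk - D0 *\<^sub>v zk"
    unfolding v_def mult_minus_distrib_mat_vec[OF M zt(1) lin_comb_carrier] by (simp only: sol zt(2))
  also have "\<dots> = 0\<^sub>v N" using D0c zk by simp
  finally have Mv0: "D1 *\<^sub>v v - \<sigma> \<cdot>\<^sub>v (D0 *\<^sub>v v) = 0\<^sub>v N" unfolding Mv[OF v] .
  have "D1 *\<^sub>v v = \<sigma> \<cdot>\<^sub>v (D0 *\<^sub>v v)"
  proof (rule eq_vecI)
    fix d assume "d < dim_vec (\<sigma> \<cdot>\<^sub>v (D0 *\<^sub>v v))"
    then show "(D1 *\<^sub>v v) $ d = (\<sigma> \<cdot>\<^sub>v (D0 *\<^sub>v v)) $ d"
      using arg_cong[OF Mv0, of "\<lambda>w. w $ d"] D0c by (simp del: index_mult_mat_vec)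
  qed (use D0c D1c in simp)
  then have "v = 0\<^sub>v N"
    using shift v by (auto simp: pencil_eigenvalue_def pencil_eigenvector_def)
  then have "zt = lin_comb N {..<Ns} b z"
  proof (intro eq_vecI)
    fix d assume "d < dim_vec (lin_comb N {..<Ns} b z)"
    then have "d < N" by (simp add: lin_comb_def)
    then show "zt $ d = lin_comb N {..<Ns} b z $ d"
      using arg_cong[OF \<open>v = 0\<^sub>v N\<close>, of "\<lambda>v. v $ d"] by (simp add: v_def lin_comb_def)
  qed (use zt(1) in \<open>simp add: lin_comb_def\<close>)
  then have "zk1 = complex_of_real (1 / vec_norm zt) \<cdot>\<^sub>v lin_comb N {..<Ns} b z"
    using zk1 by metis
  also have "\<dots> = lin_comb N {..<Ns} (\<lambda>i. complex_of_real (1 / vec_norm zt) * b i) z"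
    by (intro eq_vecI) (simp_all add: lin_comb_def sum_distrib_left mult.assoc)
  finally have zk1_comb: "zk1 = lin_comb (n ^ (m + 1)) {..<Ns}
      (\<lambda>i. complex_of_real (1 / vec_norm zt) * b i) (\<lambda>i. kron_power (m + 1) (snd (h i)))"
    unfolding z_def N .
  show ?thesis
    unfolding symmetric_vec_iff_lin_comb
  proof (intro exI conjI)
    show "\<forall>j<Ns. snd (h j) \<in> carrier_vec n" using hx(1) by blast
  qed (rule zk1_comb)
qed

end
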